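(* Consider the MIMO-OFDM communication signal model $$\mathbf Y_{\rm com}=\mathbf X\mathbf H+\mathbf W_{\rm com},$$ with $\mathbf X=\mathrm{diag}\{\mathbf X(0),\dots,\mathbf X(N_c-1)\}\in\mathbb C^{N_cN_x\times N_cN_t}$ the block diagonal transmit data matrix, $\mathbf H=[\mathbf H^T(0),\dots,\mathbf H^T(N_c-1)]^T$ the communication channel, and $\mathbf W_{\rm com}$ the noise, so that on subcarrier $p$ one has $\mathbf Y_{\rm com}(p)=\mathbf X(p)\mathbf H(p)+\mathbf W_{\rm com}(p)$. Then, with $\Sigma_{\mathbf X}=\mathbb E\{\mathbf X^H\mathbf X\}/N_x$, the communication mutual information is $$I(\mathbf X;\mathbf Y_{\rm com}|\mathbf H)=N_x\log_2\left[(\sigma_n^2)^{-N_rN_c}\det\left(\mathbf H^H\Sigma_{\mathbf X}\mathbf H+\sigma_n^2\mathbf I_{N_rN_c}\right)\right],$$ where inside the determinant $\mathbf H$ denotes the same channel written in block diagonal form, $\mathrm{diag}\{\mathbf H(0),\dots,\mathbf H(N_c-1)\}\in\mathbb C^{N_tN_c\times N_rN_c}$.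
   Context: $N_c$ is the number of subcarriers, $N_x$ the number of OFDM symbols, $N_t$ and $N_r$ the numbers of transmit and receive antenna elements. For $p=0,\dots,N_c-1$: $\mathbf X(p)\in\mathbb C^{N_x\times N_t}$ is the transmit data on subcarrier $p$; $\mathbf H(p)=\sum_{l=0}^{L_c}\mathbf H_l e^{-j(2\pi/N_c)lp}\in\mathbb C^{N_t\times N_r}$ is the frequency-domain channel matrix, where $\mathbf H_l=\mathbf R_l^{1/2}\mathbf H_{\omega,l}$ is the channel of the $l$-th path, with $\mathbf R_l$ the transmit antenna correlation matrix and $\mathbf H_{\omega,l}$ having i.i.d. $\mathcal{CN}(0,1)$ entries, independent for different paths; $\mathbf W_{\rm com}(p)\in\mathbb C^{N_x\times N_r}$ has entries i.i.d. $\mathcal{CN}(0,\sigma_n^2)$. $\mathbf Y_{\rm com}$ and $\mathbf W_{\rm com}$, in $\mathbb C^{N_cN_x\times N_r}$, are the $\mathbf Y_{\rm com}(p)$ and $\mathbf W_{\rm com}(p)$ stacked vertically in the same way as $\mathbf H$. The channel is perfectly known (perfect channel state information). The communication mutual information is the mutual information (in bits) between transmitted and received signals given the channel, $I(\mathbf X;\mathbf Y_{\rm com}|\mathbf H)=h(\mathbf Y_{\rm com}|\mathbf H)-h(\mathbf W_{\rm com})$, with $h$ the differential entropy. $\mathcal{CN}(0,\sigma^2)$ is the zero-mean circularly symmetric complex Gaussian law of variance $\sigma^2$, $\mathbb E$ is expectation, $(\cdot)^H$ is conjugate transpose, $\mathbf I_n$ is the identity, and $\mathrm{diag}\{\cdot\}$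 of matrices is block diagonal.
   Formalization: Added, since the formula fails e.g. for discrete X: X, H and W_com are mutually independent, W_com is i.i.d. across subcarriers, and the rows of the X(p) are independent zero-mean circularly symmetric Gaussian vectors, identically distributed over the OFDM symbols for each p. *)

theory Defs
  imports "HOL-Analysis.Analysis" "HOL-Probability.Probability"
begin

section \<open>Complex matrices\<close>

definition ctranspose :: "complex^'n^'m \<Rightarrow> complex^'m^'n" where
  "ctranspose A = (\<chi> i j. cnj (A $ j $ i))"

definition psd :: "complex^'n^'n \<Rightarrow> bool" where
  "psd A \<longleftrightarrow> ctranspose A = A \<and>
     (\<forall>v. 0 \<le> Re (\<Sum>i\<in>UNIV. cnj (v $ i) * (A *v v) $ i))"

text \<open>The unique positive semidefinite square root; meaningful only for positive semidefinite
  arguments.\<close>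

definition psd_sqrt :: "complex^'n^'n \<Rightarrow> complex^'n^'n" where
  "psd_sqrt A = (THE S. psd S \<and> S ** S = A)"

text \<open>Families of matrices indexed by \<open>'c\<close>, arranged as a block diagonal matrix or as a vertical
  stack. Rows and columns of the large matrix are indexed by pairs (block, index in the block).\<close>

definition block_diag :: "('c::finite \<Rightarrow> complex^'n^'m) \<Rightarrow> complex^('c \<times> 'n)^('c \<times> 'm)" where
  "block_diag A = (\<chi> u v. if fst u = fst v then A (fst u) $ snd u $ snd v else 0)"

definition stack :: "('c::finite \<Rightarrow> complex^'n^'m) \<Rightarrow> complex^'n^('c \<times> 'm)" where
  "stack A = (\<chi> u. A (fst u) $ snd u)"

lemma block_diag_mult_stack:
  fixes A :: "'c::finite \<Rightarrow> complex^'n^'m" and B :: "'c \<Rightarrow> complex^'k^'n"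
  shows "block_diag A ** stack B = stack (\<lambda>p. A p ** B p)"
proof -
  have "(\<Sum>u\<in>UNIV. (if p = fst u then A p $ i $ snd u else 0) * B (fst u) $ snd u $ j)
      = (\<Sum>s\<in>UNIV. A p $ i $ s * B p $ s $ j)" for p i j
  proof -
    have "(\<Sum>u\<in>UNIV. (if p = fst u then A p $ i $ snd u else 0) * B (fst u) $ snd u $ j)
        = (\<Sum>q\<in>UNIV. \<Sum>s\<in>UNIV. (if p = q then A p $ i $ s else 0) * B q $ s $ j)"
      unfolding UNIV_Times_UNIV [symmetric] sum.cartesian_product by (simp add: case_prod_beta)
    also have "\<dots> = (\<Sum>q\<in>UNIV. if p = q then (\<Sum>s\<in>UNIV. A p $ i $ s * B q $ s $ j) else 0)"
      by (intro sum.cong) auto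
    finally show ?thesis by simp
  qed
  then show ?thesis
    by (simp add: vec_eq_iff matrix_matrix_mult_def block_diag_def stack_def)
qed

section \<open>The frequency-domain channel\<close>

text \<open>The elements of the index type \<open>'c\<close> in increasing order get the numbers
  \<open>0, \<dots>, CARD('c) - 1\<close>.\<close>

definition subcarrier_no :: "'c::{finite,linorder} \<Rightarrow> nat" where
  "subcarrier_no p = card {..<p}"

lemma bij_betw_subcarrier_no:
  "bij_betw subcarrier_no (UNIV :: 'c::{finite,linorder} set) {..<CARD('c)}"
proof -
  have mono: "subcarrier_no p < subcarrier_no q" if "p < q" for p q :: 'c
    unfolding subcarrier_no_def using that by (intro psubset_card_mono) auto
  have inj: "inj (subcarrier_no :: 'c \<Rightarrow> nat)"
    by (rule injI) (metis mono less_irrefl linorder_neqE)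
  have "subcarrier_no p < CARD('c)" for p :: 'c
    unfolding subcarrier_no_def by (intro psubset_card_mono) auto
  then have "range (subcarrier_no :: 'c \<Rightarrow> nat) \<subseteq> {..<CARD('c)}" by auto
  moreover have "card (range (subcarrier_no :: 'c \<Rightarrow> nat)) = CARD('c)"
    using inj by (rule card_image)
  ultimately have "range (subcarrier_no :: 'c \<Rightarrow> nat) = {..<CARD('c)}"
    by (intro card_subset_eq) auto
  with inj show ?thesis by (simp add: bij_betw_def)
qed

definition freq_channel ::
    "nat \<Rightarrow> (nat \<Rightarrow> complex^'r^'t) \<Rightarrow> 'c::{finite,linorder} \<Rightarrow> complex^'r^'t" where
  "freq_channel Lc G p = (\<chi> i j. \<Sum>l\<le>Lc.
     G l $ i $ j * exp (- \<i> * of_real (2 * pi / CARD('c) * l * subcarrier_no p)))"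

section \<open>Circularly symmetric complex Gaussian laws\<close>

text \<open>The law \<open>CN(0, v)\<close>, where \<open>v > 0\<close> is the expected squared modulus.\<close>

definition complex_normal :: "real \<Rightarrow> complex measure" where
  "complex_normal v = density lborel (\<lambda>z. ennreal (exp (- (cmod z)\<^sup>2 / v) / (pi * v)))"

definition iid_complex_normal ::
    "'w measure \<Rightarrow> real \<Rightarrow> 'i set \<Rightarrow> ('i \<Rightarrow> 'w \<Rightarrow> complex) \<Rightarrow> bool" where
  "iid_complex_normal M v I Z \<longleftrightarrow>
     prob_space.indep_vars M (\<lambda>_. borel) Z I \<and> (\<forall>i\<in>I. distr M borel (Z i) = complex_normal v)"

text \<open>Zero-mean circularly symmetric Gaussian laws on \<open>complex^'n\<close> are the laws of linear images
  of vectors of independent standard complex normals. Degenerate laws are included: the covariance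
  matrix is \<open>A ** ctranspose A\<close>, and every positive semidefinite matrix has this form with
  square \<open>A\<close>.\<close>

definition circular_gaussian :: "(complex^'n) measure \<Rightarrow> bool" where
  "circular_gaussian \<mu> \<longleftrightarrow> (\<exists>A :: complex^'n^'n.
     \<mu> = distr (\<Pi>\<^sub>M k\<in>UNIV. complex_normal 1) borel (\<lambda>z. A *v (\<chi> k. z k)))"

section \<open>Independence and conditional laws\<close>

text \<open>The library constant \<open>indep_var\<close> requires both variables to have the same value type.\<close>

definition indep_rvs ::
    "'w measure \<Rightarrow> 'a measure \<Rightarrow> ('w \<Rightarrow> 'a) \<Rightarrow> 'b measure \<Rightarrow> ('w \<Rightarrow> 'b) \<Rightarrow> bool" where
  "indep_rvs M S U T V \<longleftrightarrow> U \<in> measurable M S \<and> V \<in> measurable M T \<and>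
     prob_space.indep_set M {U -` A \<inter> space M | A. A \<in> sets S} {V -` B \<inter> space M | B. B \<in> sets T}"

text \<open>\<open>K\<close> is a version of the regular conditional distribution of \<open>Z\<close> given \<open>H\<close>.\<close>

definition cond_law ::
    "'w measure \<Rightarrow> 'h measure \<Rightarrow> 'z measure \<Rightarrow> ('w \<Rightarrow> 'h) \<Rightarrow> ('w \<Rightarrow> 'z) \<Rightarrow> ('h \<Rightarrow> 'z measure) \<Rightarrow> bool"
  where
  "cond_law M S T H Z K \<longleftrightarrow> K \<in> measurable S (prob_algebra T) \<and>
     (\<forall>A\<in>sets S. \<forall>B\<in>sets T.
        emeasure M {\<omega> \<in> space M. H \<omega> \<in> A \<and> Z \<omega> \<in> B}
          = (\<integral>\<^sup>+h\<in>A. emeasure (K h) B \<partial>distr M S H))"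

end

theory Submission
  imports Defs
begin

text \<open>
  Given the channel, the received signal is \<open>Y = \<phi>(X) + W\<close> with \<open>\<phi>\<close> linear and \<open>W\<close> independent of
  \<open>X\<close>, so the joint law has density \<open>g (y - \<phi> x) / f y\<close> with respect to the product of its marginals
  (\<open>g\<close>, \<open>f\<close> the densities of \<open>W\<close>, \<open>Y\<close>), even if the law of \<open>X\<close> is degenerate. Hence the mutual
  information is \<open>h(Y) - h(W)\<close>. The rows of \<open>X\<close> are images \<open>A\<^sub>p z\<close> of standard Gaussian vectors, so
  the rows of \<open>Y\<close> are \<open>B\<^sub>p z + \<surd>v w\<close> with \<open>B\<^sub>p = H\<^sub>p\<^sup>T A\<^sub>p\<close>. Diagonalize
  \<open>B\<^sub>p B\<^sub>p\<^sup>H + v I = D\<^sub>p D\<^sub>p\<^sup>H\<close> with \<open>D\<^sub>p\<close> unitary times diagonal. Then \<open>Y\<close> has the law of \<open>D u\<close>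
  for a standard Gaussian \<open>u\<close>, because coisometries preserve standard Gaussian laws, and the Jacobian
  of \<open>D\<close> is immediate. Since \<open>E \<bar>u\<bar>\<^sup>2\<close> is finite and occurs in both entropies, its value cancels,
  leaving the logarithm of \<open>det D D\<^sup>H / det (v I)\<close>. Finally \<open>D D\<^sup>H\<close> is, block by block, the transpose of
  \<open>H\<^sup>H \<Sigma>\<^sub>X H + v I\<close>.
\<close>

section \<open>Isometries preserve Lebesgue measure\<close>

text \<open>A complex matrix lives in a real Euclidean space of twice its complex dimension, so a
  real Jacobian has to be matched with a complex determinant. It is therefore split into an isometry
  and a coordinate scaling. The isometry preserves Lebesgue measure because the image measure is
  translation invariant, hence determined by its value on one ball. In the scaling, each eigenvalue
  \<open>l\<close> of the complex matrix stretches two real coordinates by \<open>sqrt l\<close>;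
  the Jacobian is thus the product of the eigenvalues themselves, and the logarithm carries no
  factor 1/2. With \<open>Q (z, w) = D^-1 (B z + \<surd>v w)\<close>, the coisometry property is
  \<open>Q Q^H = D^-1 (B B^H + v I) D^-H = I\<close>; the noise term \<open>v I\<close> makes
  \<open>D\<close> invertible even if \<open>B\<close> is singular. Transposes enter because rows of
  the signal are treated as column vectors. The factor N_x arises because all rows of one subcarrier
  share the same matrix. The conditional law is known only as some version \<open>K\<close>, so the
  kernel obtained by freezing the channel agrees with it just almost everywhere.\<close>

lemma nn_integral_translate:
  fixes M :: "'a::euclidean_space measure"
  assumes inv: "\<And>c. distr M borel ((+) c) = M"
    and [measurable_cong]: "sets M = sets borel"
    and [measurable]: "f \<in> borel_measurable borel"
  shows "(\<integral>\<^sup>+x. f (c + x) \<partial>M) = (\<integral>\<^sup>+x. f x \<partial>M)"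
proof -
  have "(\<integral>\<^sup>+x. f x \<partial>M) = (\<integral>\<^sup>+x. f x \<partial>distr M borel ((+) c))"
    by (simp only: inv)
  also have "\<dots> = (\<integral>\<^sup>+x. f (c + x) \<partial>M)"
    by (rule nn_integral_distr) auto
  finally show ?thesis by simp
qed

lemma nn_integral_lborel_uminus:
  fixes f :: "'a::euclidean_space \<Rightarrow> ennreal"
  assumes [measurable]: "f \<in> borel_measurable borel"
  shows "(\<integral>\<^sup>+x. f (- x) \<partial>lborel) = (\<integral>\<^sup>+x. f x \<partial>lborel)"
proof -
  have "(lborel :: 'a measure) = distr lborel borel uminus"
    using lborel_affine[of "-1" "0::'a"] by (simp add: density_1)
  then have "(\<integral>\<^sup>+x. f x \<partial>lborel) = (\<integral>\<^sup>+x. f x \<partial>distr lborel borel uminus)"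
    by simp
  also have "\<dots> = (\<integral>\<^sup>+x. f (- x) \<partial>lborel)"
    by (rule nn_integral_distr) auto
  finally show ?thesis by simp
qed

text \<open>The double-integral argument for uniqueness of Haar measure: the indicator of
  \<open>x \<in> A\<close> and \<open>x + y \<in> B\<close> is integrated in both orders, with a
  shift in between that moves the dependence on \<open>y\<close> from \<open>B\<close> to
  \<open>A\<close>. The product form avoids dividing by measures that may be 0 or infinite.\<close>

lemma translation_invariant_measure_unique:
  fixes M :: "'a::euclidean_space measure"
  assumes inv: "\<And>c. distr M borel ((+) c) = M"
    and sets_M [measurable_cong]: "sets M = sets borel"
    and "sigma_finite_measure M"
    and [measurable]: "A \<in> sets borel" "B \<in> sets borel"
  shows "emeasure M A * emeasure lborel B = emeasure M B * emeasure lborel A"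
proof -
  interpret M: sigma_finite_measure M by fact
  interpret P: pair_sigma_finite M lborel by standard
  have A: "emeasure M A = (\<integral>\<^sup>+x. indicator A x \<partial>M)" and B: "emeasure M B = (\<integral>\<^sup>+x. indicator B x \<partial>M)"
    using sets_M by auto
  have "emeasure M A * emeasure lborel B = (\<integral>\<^sup>+x. indicator A x * (\<integral>\<^sup>+y. indicator B y \<partial>lborel) \<partial>M)"
    unfolding A by (subst nn_integral_multc) auto
  also have "\<dots> = (\<integral>\<^sup>+x. indicator A x * (\<integral>\<^sup>+y. indicator B (x + y) \<partial>lborel) \<partial>M)"
    by (subst nn_integral_translate[where M=lborel]) (auto simp: lborel_distr_plus)
  also have "\<dots> = (\<integral>\<^sup>+x. \<integral>\<^sup>+y. indicator A x * indicator B (y + x) \<partial>lborel \<partial>M)"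
    by (subst nn_integral_cmult[symmetric]) (auto simp: add.commute)
  also have "\<dots> = (\<integral>\<^sup>+y. \<integral>\<^sup>+x. indicator A x * indicator B (y + x) \<partial>M \<partial>lborel)"
    by (rule P.Fubini'[symmetric]) measurable
  \<comment> \<open>For fixed \<open>y\<close> the integrand now depends on \<open>x\<close> only
    through \<open>y + x\<close>, so invariance of \<open>M\<close> removes the shift.\<close>
  also have "\<dots> = (\<integral>\<^sup>+y. \<integral>\<^sup>+x. indicator A (- y + (y + x)) * indicator B (y + x) \<partial>M \<partial>lborel)"
    by simp
  also have "\<dots> = (\<integral>\<^sup>+y. \<integral>\<^sup>+x. indicator A (- y + x) * indicator B x \<partial>M \<partial>lborel)"
    by (subst nn_integral_translate[OF inv sets_M, where f="\<lambda>x. indicator A (- y + x) * indicator B x" for y]) auto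
  also have "\<dots> = (\<integral>\<^sup>+x. \<integral>\<^sup>+y. indicator A (- y + x) * indicator B x \<partial>lborel \<partial>M)"
    by (rule P.Fubini') measurable
  also have "\<dots> = (\<integral>\<^sup>+x. (\<integral>\<^sup>+y. indicator A (- y + x) \<partial>lborel) * indicator B x \<partial>M)"
    by (subst nn_integral_multc) auto
  also have "\<dots> = (\<integral>\<^sup>+x. (\<integral>\<^sup>+y. indicator A (x + y) \<partial>lborel) * indicator B x \<partial>M)"
    by (subst nn_integral_lborel_uminus[where f="\<lambda>y. indicator A (y + x)" for x]) (auto simp: add.commute)
  also have "\<dots> = (\<integral>\<^sup>+x. emeasure lborel A * indicator B x \<partial>M)"
    by (subst nn_integral_translate[where M=lborel]) (auto simp: lborel_distr_plus)
  also have "\<dots> = emeasure M B * emeasure lborel A"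
    unfolding B by (subst nn_integral_cmult) (auto simp: mult.commute)
  finally show ?thesis .
qed

text \<open>The push-forward of Lebesgue measure is translation invariant and gives the unit ball the
  right measure.\<close>

lemma lborel_distr_isometry:
  fixes f :: "'a::euclidean_space \<Rightarrow> 'b::euclidean_space"
  assumes "linear f" and norm: "\<And>x. norm (f x) = norm x" and dim: "DIM('a) = DIM('b)"
  shows "distr lborel borel f = lborel"
proof -
  interpret f: linear f by fact
  have [measurable]: "f \<in> borel_measurable borel"
    using \<open>linear f\<close> by (intro borel_measurable_continuous_onI linear_continuous_on)
      (simp add: linear_conv_bounded_linear)
  have "inj f"
    by (metis f.inj_iff_eq_0 norm norm_eq_zero)
  then have "surj f"
    using dim by (metis \<open>linear f\<close> dim_UNIV dim_image_eq span_UNIV dim_eq_full f.linear_axioms 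
        linear_subspace_image span_eq_iff subspace_UNIV inj_on_subset subset_UNIV)
  have ball: "f -` ball 0 r = ball 0 r" for r
    by (auto simp: norm)
  let ?M = "distr lborel borel f"
  \<comment> \<open>Since \<open>f\<close> is linear and onto, every translation of the target is
    the image under \<open>f\<close> of a translation of the source.\<close>
  have inv: "distr ?M borel ((+) c) = ?M" for c
  proof -
    obtain d where d: "c = f d" using \<open>surj f\<close> by (metis surjD)
    have "distr ?M borel ((+) c) = distr lborel borel (f \<circ> (+) d)"
      by (subst distr_distr) (auto simp: o_def d f.add)
    also have "\<dots> = distr (distr lborel borel ((+) d)) borel f"
      by (subst distr_distr) (auto simp: o_def)
    finally show ?thesis by (simp add: lborel_distr_plus)
  qed
  have ball': "emeasure ?M (ball 0 r) = emeasure (lborel :: 'a measure) (ball 0 r)" for r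
    by (subst emeasure_distr) (auto simp: ball)
  have sf: "sigma_finite_measure ?M"
  proof
    show "\<exists>A. countable A \<and> A \<subseteq> sets ?M \<and> \<Union> A = space ?M \<and> (\<forall>a\<in>A. emeasure ?M a \<noteq> \<infinity>)"
    proof (intro exI conjI)
      show "countable (range (\<lambda>n::nat. ball (0::'b) (real n)))" by simp
      show "\<Union> (range (\<lambda>n::nat. ball (0::'b) (real n))) = space ?M"
        by (auto simp: reals_Archimedean2)
      show "\<forall>a\<in>range (\<lambda>n::nat. ball (0::'b) (real n)). emeasure ?M a \<noteq> \<infinity>"
        using emeasure_lborel_ball_finite[of "0::'a"] by (auto simp: ball' less_top)
    qed auto
  qed
  show ?thesis
  proof (rule measure_eqI)
    fix A assume "A \<in> sets ?M"
    then have [measurable]: "A \<in> sets borel" by simp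
    have "emeasure ?M A * emeasure (lborel :: 'b measure) (ball 0 1)
        = emeasure ?M (ball 0 1) * emeasure lborel A"
      by (rule translation_invariant_measure_unique[OF inv _ sf]) auto
    moreover have "emeasure ?M (ball 0 1) = emeasure (lborel :: 'b measure) (ball 0 1)"
      by (simp add: ball' emeasure_ball dim)
    moreover have "emeasure (lborel :: 'b measure) (ball 0 1) \<noteq> 0"
      "emeasure (lborel :: 'b measure) (ball 0 1) \<noteq> \<top>"
      using less_imp_neq[OF unit_ball_vol_pos, of "real DIM('b)"] by (auto simp: emeasure_ball simp del: unit_ball_vol_pos)
    ultimately show "emeasure ?M A = emeasure lborel A"
      by (metis ennreal_mult_cancel_left mult.commute)
  qed simp
qed

section \<open>Isotropic Gaussian measures\<close>

lemma borel_measurable_linear: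
  fixes f :: "'a::euclidean_space \<Rightarrow> 'b::euclidean_space"
  assumes "linear f"
  shows "f \<in> borel_measurable borel"
  using assms by (intro borel_measurable_continuous_onI linear_continuous_on)
    (simp add: linear_conv_bounded_linear)

lemma borel_measurable_vec_lambda:
  fixes f :: "'i::finite \<Rightarrow> 'b \<Rightarrow> 'a::euclidean_space"
  assumes [measurable]: "\<And>i. f i \<in> borel_measurable M"
  shows "(\<lambda>x. \<chi> i. f i x) \<in> borel_measurable M"
  by (subst borel_measurable_euclidean_space) (auto simp: Basis_vec_def inner_axis)

section \<open>Product measures read as measures on vectors\<close>

lemma prod_Basis_vec:
  fixes f :: "'a::euclidean_space^'n \<Rightarrow> 'b::comm_monoid_mult"
  shows "prod f Basis = (\<Prod>i\<in>UNIV. \<Prod>u\<in>Basis. f (axis i u))"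
proof -
  have "prod f Basis = prod f (\<Union>i\<in>UNIV. axis i ` (Basis :: 'a set))"
    by (simp add: Basis_vec_def UNION_singleton_eq_range)
  also have "\<dots> = (\<Prod>i\<in>UNIV. prod f (axis i ` (Basis :: 'a set)))"
    by (subst prod.UNION_disjoint) (auto simp: axis_eq_axis)
  also have "\<dots> = (\<Prod>i\<in>UNIV. \<Prod>u\<in>Basis. f (axis i u))"
    by (subst prod.reindex) (auto simp: inj_on_def axis_eq_axis)
  finally show ?thesis .
qed

text \<open>A product density factors over boxes by Fubini, and the values on boxes determine a
  product of sigma-finite measures.\<close>

lemma PiM_density:
  fixes M :: "'i \<Rightarrow> 'a measure"
  assumes "finite I" and M: "\<And>i. sigma_finite_measure (M i)"
    and N: "\<And>i. sigma_finite_measure (density (M i) (f i))"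
    and [measurable]: "\<And>i. f i \<in> borel_measurable (M i)"
  shows "(\<Pi>\<^sub>M i\<in>I. density (M i) (f i)) = density (\<Pi>\<^sub>M i\<in>I. M i) (\<lambda>x. \<Prod>i\<in>I. f i (x i))"
proof -
  interpret M: product_sigma_finite M by (rule product_sigma_finite.intro) (rule M)
  interpret N: product_sigma_finite "\<lambda>i. density (M i) (f i)" by (rule product_sigma_finite.intro) (rule N)
  have meas [measurable]: "(\<lambda>x. \<Prod>i\<in>I. f i (x i)) \<in> borel_measurable (Pi\<^sub>M I M)"
    by (intro borel_measurable_prod_ennreal measurable_compose[OF measurable_component_singleton]) auto
  show ?thesis
  proof (rule N.PiM_eqI[symmetric, OF \<open>finite I\<close>])
    fix A assume A: "\<And>i. i \<in> I \<Longrightarrow> A i \<in> sets (density (M i) (f i))"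
    then have A' [measurable]: "\<And>i. i \<in> I \<Longrightarrow> A i \<in> sets (M i)" by simp
    have PA: "Pi\<^sub>E I A \<in> sets (Pi\<^sub>M I M)"
      using A' \<open>finite I\<close> by (intro sets_PiM_I_finite) auto
    have "emeasure (density (Pi\<^sub>M I M) (\<lambda>x. \<Prod>i\<in>I. f i (x i))) (Pi\<^sub>E I A)
        = (\<integral>\<^sup>+x. (\<Prod>i\<in>I. f i (x i)) * indicator (Pi\<^sub>E I A) x \<partial>Pi\<^sub>M I M)"
      by (intro emeasure_density meas PA)
    also have "\<dots> = (\<integral>\<^sup>+x. (\<Prod>i\<in>I. f i (x i) * indicator (A i) (x i)) \<partial>Pi\<^sub>M I M)"
    proof (rule nn_integral_cong)
      fix x assume "x \<in> space (Pi\<^sub>M I M)"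
      then have "indicator (Pi\<^sub>E I A) x = (\<Prod>i\<in>I. indicator (A i) (x i) :: ennreal)"
        using \<open>finite I\<close>
        by (auto simp: indicator_def space_PiM PiE_def Pi_def prod_eq_1_iff intro!: prod_zero)
      then show "(\<Prod>i\<in>I. f i (x i)) * indicator (Pi\<^sub>E I A) x
          = (\<Prod>i\<in>I. f i (x i) * indicator (A i) (x i))"
        by (simp add: prod.distrib)
    qed
    also have "\<dots> = (\<Prod>i\<in>I. \<integral>\<^sup>+x. f i x * indicator (A i) x \<partial>M i)"
      using \<open>finite I\<close> by (intro M.product_nn_integral_prod) auto
    also have "\<dots> = (\<Prod>i\<in>I. emeasure (density (M i) (f i)) (A i))"
      by (intro prod.cong) (auto simp: emeasure_density)
    finally show "emeasure (density (Pi\<^sub>M I M) (\<lambda>x. \<Prod>i\<in>I. f i (x i))) (Pi\<^sub>E I A)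
        = (\<Prod>i\<in>I. emeasure (density (M i) (f i)) (A i))" .
  qed (auto intro!: sets_PiM_cong)
qed

text \<open>Connects the vector types with families of independent entries, whose joint laws are
  product measures on functions; open boxes split coordinatewise on both sides.\<close>

lemma lborel_vec:
  "(lborel :: ('a::euclidean_space^'n) measure)
     = distr (\<Pi>\<^sub>M i\<in>UNIV. lborel) borel (\<lambda>z. \<chi> i. z i)"
proof (rule lborel_eqI)
  interpret product_sigma_finite "\<lambda>_::'n. lborel :: 'a measure" by standard
  have [measurable]: "(\<lambda>z. \<chi> i. z i) \<in> borel_measurable (\<Pi>\<^sub>M i\<in>UNIV. (lborel :: 'a measure))"
    by (intro borel_measurable_vec_lambda) auto
  fix l u :: "'a^'n" assume le: "\<And>b. b \<in> Basis \<Longrightarrow> l \<bullet> b \<le> u \<bullet> b"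
  have le': "l $ i \<bullet> b \<le> u $ i \<bullet> b" if "b \<in> Basis" for i b
    using le[of "axis i b"] that by (simp add: inner_axis)
  have "(\<lambda>z. \<chi> i. z i) -` box l u \<inter> space (\<Pi>\<^sub>M i\<in>UNIV. (lborel :: 'a measure))
      = (\<Pi>\<^sub>E i\<in>UNIV. box (l $ i) (u $ i))"
    by (auto simp: box_def Basis_vec_def inner_axis space_PiM PiE_def Pi_def) 
  then have "emeasure (distr (\<Pi>\<^sub>M i\<in>UNIV. (lborel :: 'a measure)) borel (\<lambda>z. \<chi> i. z i)) (box l u)
      = (\<Prod>i\<in>UNIV. emeasure lborel (box (l $ i) (u $ i)))"
    by (subst emeasure_distr) (auto simp: emeasure_PiM)
  also have "\<dots> = (\<Prod>i\<in>UNIV. ennreal (\<Prod>b\<in>Basis. (u - l) \<bullet> axis i b))"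
    by (intro prod.cong refl, subst emeasure_lborel_box) (auto simp: le' inner_axis inner_diff_left)
  also have "\<dots> = ennreal (\<Prod>b\<in>Basis. (u - l) \<bullet> b)"
    unfolding prod_Basis_vec using le' 
    by (subst prod_ennreal) (auto simp: inner_axis inner_diff_left intro!: prod_nonneg)
  finally show "emeasure (distr (\<Pi>\<^sub>M i\<in>UNIV. (lborel :: 'a measure)) borel (\<lambda>z. \<chi> i. z i)) (box l u)
      = ennreal (\<Prod>b\<in>Basis. (u - l) \<bullet> b)" .
qed simp

text \<open>Centred Gaussian law with variance \<open>v / 2\<close> in each real coordinate. On
  \<open>complex\<close> this is CN(0, v), and on complex vectors or matrices it is the law of
  i.i.d. CN(0, v) entries; one definition serves all these types as well as their products.\<close>

definition gauss :: "real \<Rightarrow> 'a::euclidean_space measure" where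
  "gauss v = density lborel (\<lambda>x. ennreal (exp (- (norm x)\<^sup>2 / v) / sqrt (pi * v) ^ DIM('a)))"

lemma sets_gauss [simp, measurable_cong]: "sets (gauss v) = sets borel"
  by (simp add: gauss_def)

lemma space_gauss [simp]: "space (gauss v) = UNIV"
  by (simp add: gauss_def)

lemma gauss_density_eq_normal:
  assumes "v > 0"
  shows "exp (- x\<^sup>2 / v) / sqrt (pi * v) = normal_density 0 (sqrt (v / 2)) x"
  using assms by (simp add: normal_density_def field_simps)

lemma gauss_density_eq_prod:
  fixes x :: "'a::euclidean_space"
  assumes "v > 0"
  shows "exp (- (norm x)\<^sup>2 / v) / sqrt (pi * v) ^ DIM('a)
     = (\<Prod>b\<in>Basis. normal_density 0 (sqrt (v / 2)) (x \<bullet> b))"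
proof -
  have "(\<Prod>b\<in>(Basis::'a set). normal_density 0 (sqrt (v / 2)) (x \<bullet> b))
     = (\<Prod>b\<in>(Basis::'a set). exp (- (x \<bullet> b)\<^sup>2 / v) / sqrt (pi * v))"
    using assms by (simp only: gauss_density_eq_normal)
  also have "\<dots> = exp (\<Sum>b\<in>Basis. - (x \<bullet> b)\<^sup>2 / v) / sqrt (pi * v) ^ DIM('a)"
    by (simp add: prod_dividef exp_sum)
  also have "(\<Sum>b\<in>Basis. - (x \<bullet> b)\<^sup>2 / v) = - (norm x)\<^sup>2 / v"
    by (simp add: norm_eq_sqrt_inner euclidean_inner[of x x] power2_eq_square sum_nonneg
        sum_divide_distrib sum_negf)
  finally show ?thesis by simp
qed

lemma prob_space_gauss:
  assumes "v > 0"
  shows "prob_space (gauss v :: 'a::euclidean_space measure)"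
proof
  have "emeasure (gauss v :: 'a measure) (space (gauss v))
      = (\<integral>\<^sup>+x. (\<Prod>b\<in>Basis. ennreal (normal_density 0 (sqrt (v / 2)) (x \<bullet> b))) \<partial>(lborel :: 'a measure))"
    unfolding gauss_def gauss_density_eq_prod[OF assms]
    by (simp add: emeasure_density prod_ennreal)
  also have "\<dots> = (\<Prod>b\<in>(Basis::'a set). \<integral>\<^sup>+x. ennreal (normal_density 0 (sqrt (v / 2)) x) \<partial>lborel)"
    by (rule nn_integral_lborel_prod) auto
  also have "(\<integral>\<^sup>+x. ennreal (normal_density 0 (sqrt (v / 2)) x) \<partial>lborel) = 1"
    using assms prob_space.emeasure_space_1[OF prob_space_normal_density[of "sqrt (v/2)" 0]]
    by (simp add: emeasure_density)
  finally show "emeasure (gauss v :: 'a measure) (space (gauss v)) = 1" by simp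
qed

lemma sigma_finite_gauss: "v > 0 \<Longrightarrow> sigma_finite_measure (gauss v)"
  using prob_space_gauss prob_space_imp_sigma_finite by blast

lemma complex_normal_eq_gauss: "v > 0 \<Longrightarrow> complex_normal v = gauss v"
  by (simp add: complex_normal_def gauss_def)

text \<open>The density depends on the norm only, and Lebesgue measure is invariant; equal
  dimensions make the normalising constants agree.\<close>

lemma gauss_distr_isometry:
  fixes f :: "'a::euclidean_space \<Rightarrow> 'b::euclidean_space"
  assumes "linear f" and norm: "\<And>x. norm (f x) = norm x" and dim: "DIM('a) = DIM('b)"
  shows "distr (gauss v) borel f = gauss v"
proof -
  have [measurable]: "f \<in> borel_measurable borel"
    by (intro borel_measurable_linear assms)
  have "gauss v = density (distr lborel borel f)
      (\<lambda>y::'b. ennreal (exp (- (norm y)\<^sup>2 / v) / sqrt (pi * v) ^ DIM('b)))"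
    by (simp add: lborel_distr_isometry[OF assms] gauss_def)
  also have "\<dots> = distr (gauss v) borel f"
    by (subst density_distr) (auto simp: gauss_def norm dim)
  finally show ?thesis by simp
qed

text \<open>Pythagoras merges the two exponents. Signal and noise can thereby be treated as one
  isotropic vector \<open>(z, w)\<close>.\<close>

lemma gauss_prod:
  assumes "v > 0"
  shows "(gauss v :: 'a::euclidean_space measure) \<Otimes>\<^sub>M (gauss v :: 'b::euclidean_space measure) = gauss v"
proof -
  have "(gauss v :: 'a measure) \<Otimes>\<^sub>M (gauss v :: 'b measure)
    = density (lborel \<Otimes>\<^sub>M lborel) (\<lambda>(x::'a, y::'b). ennreal (exp (- (norm x)\<^sup>2 / v) / sqrt (pi * v) ^ DIM('a))
        * ennreal (exp (- (norm y)\<^sup>2 / v) / sqrt (pi * v) ^ DIM('b)))"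
    unfolding gauss_def
    using sigma_finite_gauss[OF assms, where 'a='b, unfolded gauss_def]
    by (intro pair_measure_density) (auto intro: lborel.sigma_finite_measure_axioms)
  also have "\<dots> = gauss v"
    unfolding gauss_def lborel_prod[symmetric]
  proof (intro arg_cong2[where f=density] refl ext, clarify)
    fix x :: 'a and y :: 'b
    have "ennreal (exp (- (norm x)\<^sup>2 / v) / sqrt (pi * v) ^ DIM('a))
        * ennreal (exp (- (norm y)\<^sup>2 / v) / sqrt (pi * v) ^ DIM('b))
      = ennreal ((exp (- (norm x)\<^sup>2 / v) / sqrt (pi * v) ^ DIM('a))
        * (exp (- (norm y)\<^sup>2 / v) / sqrt (pi * v) ^ DIM('b)))"
      using assms by (subst ennreal_mult) auto
    also have "(exp (- (norm x)\<^sup>2 / v) / sqrt (pi * v) ^ DIM('a))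
        * (exp (- (norm y)\<^sup>2 / v) / sqrt (pi * v) ^ DIM('b))
      = exp (- (norm (x, y))\<^sup>2 / v) / sqrt (pi * v) ^ DIM('a \<times> 'b)"
    proof -
      have "- (norm (x, y))\<^sup>2 / v = - (norm x)\<^sup>2 / v + - (norm y)\<^sup>2 / v"
        by (simp add: norm_Pair add_divide_distrib diff_divide_distrib)
      then show ?thesis
        by (simp only: exp_add DIM_prod power_add times_divide_times_eq)
    qed
    finally show "ennreal (exp (- (norm x)\<^sup>2 / v) / sqrt (pi * v) ^ DIM('a))
        * ennreal (exp (- (norm y)\<^sup>2 / v) / sqrt (pi * v) ^ DIM('b))
      = ennreal (exp (- (norm (x, y))\<^sup>2 / v) / sqrt (pi * v) ^ DIM('a \<times> 'b))" .
  qed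
  finally show ?thesis .
qed

lemma gauss_vec:
  assumes "v > 0"
  shows "(gauss v :: ('a::euclidean_space^'n) measure) = distr (\<Pi>\<^sub>M i\<in>UNIV. gauss v) borel (\<lambda>z. \<chi> i. z i)"
proof -
  have [measurable]: "(\<lambda>z. \<chi> i::'n. z i) \<in> borel_measurable (\<Pi>\<^sub>M i\<in>UNIV. (lborel :: 'a measure))"
    by (intro borel_measurable_vec_lambda) auto
  let ?d = "\<lambda>x::'a. ennreal (exp (- (norm x)\<^sup>2 / v) / sqrt (pi * v) ^ DIM('a))"
  have "gauss v = density (distr (\<Pi>\<^sub>M i\<in>UNIV. lborel) borel (\<lambda>z. \<chi> i. z i))
      (\<lambda>x::'a^'n. ennreal (exp (- (norm x)\<^sup>2 / v) / sqrt (pi * v) ^ DIM('a^'n)))"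
    by (simp add: gauss_def lborel_vec[symmetric])
  also have "\<dots> = distr (density (\<Pi>\<^sub>M i\<in>UNIV. lborel)
      (\<lambda>z. ennreal (exp (- (norm (\<chi> i::'n. (z i :: 'a)))\<^sup>2 / v) / sqrt (pi * v) ^ DIM('a^'n)))) borel (\<lambda>z. \<chi> i. z i)"
    by (subst density_distr) auto
  also have "(\<lambda>z. ennreal (exp (- (norm (\<chi> i::'n. (z i :: 'a)))\<^sup>2 / v) / sqrt (pi * v) ^ DIM('a^'n)))
      = (\<lambda>z. \<Prod>i\<in>UNIV. ?d (z i))"
  proof
    fix z :: "'n \<Rightarrow> 'a"
    have "(\<Prod>i\<in>UNIV. ?d (z i)) = ennreal (\<Prod>i\<in>UNIV. exp (- (norm (z i))\<^sup>2 / v) / sqrt (pi * v) ^ DIM('a))"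
      using assms by (intro prod_ennreal) auto
    also have "(\<Prod>i\<in>UNIV. exp (- (norm (z i))\<^sup>2 / v) / sqrt (pi * v) ^ DIM('a))
       = exp (- (norm (\<chi> i::'n. (z i :: 'a)))\<^sup>2 / v) / sqrt (pi * v) ^ DIM('a^'n)"
      by (simp add: prod_dividef exp_sum[symmetric] norm_vec_def L2_set_def sum_nonneg power_mult[symmetric]
          sum_divide_distrib sum_negf mult.commute)
    finally show "ennreal (exp (- (norm (\<chi> i::'n. (z i :: 'a)))\<^sup>2 / v) / sqrt (pi * v) ^ DIM('a^'n))
      = (\<Prod>i\<in>UNIV. ?d (z i))" by simp
  qed
  also have "density (\<Pi>\<^sub>M i\<in>UNIV. lborel) (\<lambda>z. \<Prod>i\<in>UNIV. ?d (z i)) = (\<Pi>\<^sub>M i\<in>(UNIV::'n set). gauss v)"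
    unfolding gauss_def using sigma_finite_gauss[OF assms, where 'a='a, unfolded gauss_def]
    by (intro PiM_density[symmetric]) (auto intro: lborel.sigma_finite_measure_axioms)
  finally show ?thesis .
qed

text \<open>Half of the exponent absorbs the square, which leaves a multiple of the density of
  \<open>gauss (2 * v)\<close>, a measure of mass 1.\<close>

lemma integrable_gauss_norm_square:
  assumes "v > 0"
  shows "integrable (gauss v) (\<lambda>x::'a::euclidean_space. (norm x)\<^sup>2)"
proof (rule integrableI_bounded)
  \<comment> \<open>The factor \<open>2 * v\<close> comes from \<open>s \<le> exp s\<close> at
    \<open>s = (norm x)^2 / (2 * v)\<close>; the quotient converts the normalising constant of
    \<open>gauss v\<close> into that of \<open>gauss (2 * v)\<close>.\<close>
  let ?c = "2 * v * (sqrt (pi * (2 * v)) ^ DIM('a) / sqrt (pi * v) ^ DIM('a))"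
  have "(\<integral>\<^sup>+x. ennreal (norm ((norm x)\<^sup>2)) \<partial>(gauss v :: 'a measure))
      = (\<integral>\<^sup>+x. ennreal (exp (- (norm x)\<^sup>2 / v) / sqrt (pi * v) ^ DIM('a) * (norm x)\<^sup>2) \<partial>(lborel :: 'a measure))"
    unfolding gauss_def using assms by (subst nn_integral_density) (auto simp: ennreal_mult[symmetric])
  also have "\<dots> \<le> (\<integral>\<^sup>+x. ennreal ?c * ennreal (exp (- (norm x)\<^sup>2 / (2 * v)) / sqrt (pi * (2 * v)) ^ DIM('a)) \<partial>(lborel :: 'a measure))"
  proof (rule nn_integral_mono)
    fix x :: 'a
    have "exp (- (norm x)\<^sup>2 / v) * (norm x)\<^sup>2 \<le> exp (- (norm x)\<^sup>2 / v) * (2 * v * exp ((norm x)\<^sup>2 / (2 * v)))"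
    proof (intro mult_left_mono)
      have "(norm x)\<^sup>2 / (2 * v) \<le> exp ((norm x)\<^sup>2 / (2 * v))"
        using exp_ge_add_one_self[of "(norm x)\<^sup>2 / (2 * v)"] by linarith
      then show "(norm x)\<^sup>2 \<le> 2 * v * exp ((norm x)\<^sup>2 / (2 * v))"
        using assms by (simp add: field_simps)
    qed auto
    also have "\<dots> = 2 * v * exp (- (norm x)\<^sup>2 / (2 * v))"
      using assms by (simp add: mult_exp_exp field_simps)
    finally show "ennreal (exp (- (norm x)\<^sup>2 / v) / sqrt (pi * v) ^ DIM('a) * (norm x)\<^sup>2)
      \<le> ennreal ?c * ennreal (exp (- (norm x)\<^sup>2 / (2 * v)) / sqrt (pi * (2 * v)) ^ DIM('a))"
      using assms by (subst ennreal_mult[symmetric]) (auto intro!: ennreal_leI simp: divide_simps)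
  qed
  also have "\<dots> = ennreal ?c * emeasure (gauss (2 * v) :: 'a measure) (space (gauss (2 * v)))"
    by (simp add: nn_integral_cmult gauss_def emeasure_density)
  also have "\<dots> < \<infinity>"
    using prob_space.emeasure_space_1[OF prob_space_gauss[where 'a='a], of "2 * v"] assms
    by (simp del: space_gauss)
  finally show "(\<integral>\<^sup>+x. ennreal (norm ((norm x)\<^sup>2)) \<partial>(gauss v :: 'a measure)) < \<infinity>" .
qed auto

lemma gauss_second_moment:
  fixes b b' :: "'a::euclidean_space"
  assumes v: "v > 0" and b: "b \<in> Basis" "b' \<in> Basis"
  shows "has_bochner_integral (gauss v) (\<lambda>x. (x \<bullet> b) * (x \<bullet> b')) (if b = b' then v / 2 else 0)"
proof -
  have int: "integrable (gauss v) (\<lambda>x. (x \<bullet> b) * (x \<bullet> b'))"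
  proof (rule Bochner_Integration.integrable_bound[OF integrable_gauss_norm_square[OF v, where 'a='a]])
    have "\<bar>x \<bullet> b\<bar> * \<bar>x \<bullet> b'\<bar> \<le> norm x * norm x" for x
      using b by (intro mult_mono) (auto simp: Basis_le_norm)
    then show "AE x in gauss v. norm ((x \<bullet> b) * (x \<bullet> b')) \<le> norm ((norm x)\<^sup>2)"
      by (simp add: abs_mult power2_eq_square)
  qed auto
  have "(\<integral>x. (x \<bullet> b) * (x \<bullet> b') \<partial>gauss v) = (if b = b' then v / 2 else 0)"
  proof (cases "b = b'")
    case True
    define s where "s = sqrt (v / 2)"
    have s: "s > 0" "s\<^sup>2 = v / 2" using v by (auto simp: s_def)
    have one: "(\<integral>\<^sup>+x. ennreal (normal_density 0 s x) \<partial>lborel) = 1"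
      using s prob_space.emeasure_space_1[OF prob_space_normal_density[of s 0]]
      by (simp add: emeasure_density)
    have "(\<integral>\<^sup>+x. ennreal ((x \<bullet> b) * (x \<bullet> b')) \<partial>gauss v)
       = (\<integral>\<^sup>+x. (\<Prod>c\<in>Basis. ennreal (normal_density 0 s (x \<bullet> c) * (if c = b then (x \<bullet> c)\<^sup>2 else 1))) \<partial>(lborel :: 'a measure))"
      unfolding gauss_def gauss_density_eq_prod[OF v] s_def
      using b True v
      by (subst nn_integral_density)
         (auto simp: prod_nonneg ennreal_mult[symmetric] prod_ennreal prod.distrib prod.delta power2_eq_square)
    also have "\<dots> = (\<Prod>c\<in>(Basis::'a set). \<integral>\<^sup>+x. ennreal (normal_density 0 s x * (if c = b then x\<^sup>2 else 1)) \<partial>lborel)"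
      by (rule nn_integral_lborel_prod) auto
    also have "\<dots> = (\<Prod>c\<in>(Basis::'a set). if c = b then ennreal (v / 2) else 1)"
    proof (intro prod.cong refl)
      fix c :: 'a
      have "(\<integral>\<^sup>+x. ennreal (normal_density 0 s x * x\<^sup>2) \<partial>lborel) = ennreal (\<integral>x. normal_density 0 s x * x\<^sup>2 \<partial>lborel)"
        using integrable_normal_moment[of s 0 2] s by (intro nn_integral_eq_integral) auto
      also have "(\<integral>x. normal_density 0 s x * x\<^sup>2 \<partial>lborel) = v / 2"
        using integral_normal_moment_even[of s 0 1] s by simp
      finally show "(\<integral>\<^sup>+x. ennreal (normal_density 0 s x * (if c = b then x\<^sup>2 else 1)) \<partial>lborel)
          = (if c = b then ennreal (v / 2) else 1)"
        using one by simp
    qed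
    also have "\<dots> = ennreal (v / 2)"
      using b by (simp add: prod.delta)
    finally have "(\<integral>\<^sup>+x. ennreal ((x \<bullet> b) * (x \<bullet> b')) \<partial>gauss v) = ennreal (v / 2)" .
    then have "(\<integral>x. (x \<bullet> b) * (x \<bullet> b') \<partial>gauss v) = v / 2"
      using v True by (subst integral_eq_nn_integral) auto
    then show ?thesis using True by simp
  next
    case False
    \<comment> \<open>Reflection in the hyperplane orthogonal to \<open>b\<close>. It preserves
      \<open>gauss v\<close> but flips the sign of the integrand, so the integral equals its own
      negative.\<close>
    define f where "f x = x - (2 * (x \<bullet> b)) *\<^sub>R b" for x
    have lin: "linear f"
      by (auto simp: f_def intro!: linearI simp: algebra_simps inner_simps)
    have bb: "b \<bullet> b = 1" "b \<bullet> b' = 0" using b False by (auto simp: inner_Basis)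
    have nm: "norm (f x) = norm x" for x
      by (simp add: norm_eq_sqrt_inner f_def inner_simps bb inner_commute[of b x] algebra_simps)
    have [measurable]: "f \<in> borel_measurable borel" by (rule borel_measurable_linear[OF lin])
    have "(\<integral>x. (x \<bullet> b) * (x \<bullet> b') \<partial>gauss v) = (\<integral>x. (x \<bullet> b) * (x \<bullet> b') \<partial>distr (gauss v) borel f)"
      by (simp add: gauss_distr_isometry[OF lin nm])
    also have "\<dots> = (\<integral>x. - ((x \<bullet> b) * (x \<bullet> b')) \<partial>gauss v)"
      by (subst integral_distr) (auto simp: f_def inner_simps bb)
    finally show ?thesis using False by simp
  qed
  with int show ?thesis by (simp add: has_bochner_integral_iff)
qed

section \<open>Diagonalization of Hermitian matrices\<close>

text \<open>The Hermitian product, conjugate linear on the left. The Euclidean product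
  \<open>\<bullet>\<close> is only its real part: compactness and dimension arguments use
  \<open>\<bullet>\<close>, whereas unitarity requires \<open>hinner\<close>.\<close>

definition hinner :: "complex^'n \<Rightarrow> complex^'n \<Rightarrow> complex" where
  "hinner x y = (\<Sum>i\<in>UNIV. cnj (x $ i) * y $ i)"

lemma inner_eq_hinner: "x \<bullet> y = Re (hinner x y)"
  by (simp add: hinner_def inner_vec_def inner_complex_def)

lemma hinner_add_right: "hinner x (y + z) = hinner x y + hinner x z"
  by (simp add: hinner_def algebra_simps sum.distrib)

lemma hinner_smult_left: "hinner (a *s x) y = cnj a * hinner x y"
  by (simp add: hinner_def sum_distrib_left mult_ac)

lemma hinner_smult_right: "hinner x (a *s y) = a * hinner x y"
  by (simp add: hinner_def sum_distrib_left mult_ac)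

lemma cnj_hinner: "cnj (hinner x y) = hinner y x"
  by (simp add: hinner_def mult_ac)

lemma hinner_self: "hinner x x = complex_of_real ((norm x)\<^sup>2)"
  by (simp add: complex_eq_iff dot_square_norm[symmetric] inner_eq_hinner) 
     (simp add: hinner_def)

lemma hinner_mult_left: "hinner (A *v x) y = hinner x (ctranspose A *v y)"
proof -
  have "hinner (A *v x) y = (\<Sum>i\<in>UNIV. \<Sum>j\<in>UNIV. cnj (A $ i $ j) * cnj (x $ j) * y $ i)"
    by (simp add: hinner_def matrix_vector_mult_def sum_distrib_right)
  also have "\<dots> = (\<Sum>j\<in>UNIV. \<Sum>i\<in>UNIV. cnj (A $ i $ j) * cnj (x $ j) * y $ i)"
    by (rule sum.swap)
  also have "\<dots> = hinner x (ctranspose A *v y)"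
    by (simp add: hinner_def matrix_vector_mult_def ctranspose_def sum_distrib_left mult_ac)
  finally show ?thesis .
qed

lemma inner_mult_left: "(A *v x) \<bullet> y = x \<bullet> (ctranspose A *v y)"
  by (simp add: inner_eq_hinner hinner_mult_left)

lemma ctranspose_ctranspose [simp]: "ctranspose (ctranspose A) = A"
  by (simp add: ctranspose_def vec_eq_iff)

lemma ctranspose_mult: "ctranspose (A ** B) = ctranspose B ** ctranspose A"
  by (simp add: ctranspose_def vec_eq_iff matrix_matrix_mult_def mult.commute)

lemma smult_of_real: "complex_of_real a *s x = a *\<^sub>R x"
  by (simp add: vec_eq_iff scaleR_conv_of_real[where 'a=complex])

text \<open>Multiplying \<open>x\<close> by \<open>\<i>\<close> turns the imaginary part of the
  Hermitian product into a real part. Complex orthogonality thus becomes real orthogonality to two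
  vectors, as real dimension counts require.\<close>

lemma hinner_0_iff_inner: "hinner x y = 0 \<longleftrightarrow> x \<bullet> y = 0 \<and> (\<i> *s x) \<bullet> y = 0"
  by (simp add: inner_eq_hinner hinner_smult_left complex_eq_iff)

definition diag_mat :: "('n \<Rightarrow> complex) \<Rightarrow> complex^'n^'n" where
  "diag_mat d = (\<chi> i j. if i = j then d i else 0)"

text \<open>A unit vector that maximises the quadratic form on an invariant subspace is an eigenvector.\<close>

lemma hermitian_eigenvector_in_subspace:
  fixes S :: "complex^'n^'n"
  assumes herm: "ctranspose S = S"
    and W: "subspace W" "\<And>x. x \<in> W \<Longrightarrow> S *v x \<in> W"
    and nz: "x0 \<in> W" "x0 \<noteq> 0"
  obtains v l where "v \<in> W" "norm v = 1" "S *v v = l *\<^sub>R v"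
proof -
  define q where "q x = x \<bullet> (S *v x)" for x
  have lin: "linear ((*v) S)"
    by (rule matrix_vector_mul_linear)
  then have cont: "continuous_on UNIV ((*v) S)"
    by (simp add: linear_continuous_on linear_conv_bounded_linear)
  let ?K = "sphere 0 1 \<inter> W"
  have "(inverse (norm x0)) *\<^sub>R x0 \<in> ?K"
    using nz W by (auto simp: subspace_scale)
  moreover have "compact ?K"
    by (intro compact_Int_closed compact_sphere closed_subspace W)
  moreover have "continuous_on ?K q"
    unfolding q_def by (intro continuous_intros continuous_on_subset[OF cont]) auto
  ultimately obtain v where v: "v \<in> ?K" and max: "\<And>y. y \<in> ?K \<Longrightarrow> q y \<le> q v"
    using continuous_attains_sup[of ?K q] by blast
  define l where "l = q v"
  have qle: "q w \<le> l * (norm w)\<^sup>2" if "w \<in> W" for w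
  proof (cases "w = 0")
    case True then show ?thesis by (simp add: q_def)
  next
    case False
    have "q ((inverse (norm w)) *\<^sub>R w) \<le> l"
      unfolding l_def using False that W by (intro max) (auto simp: subspace_scale)
    also have "q ((inverse (norm w)) *\<^sub>R w) = q w / (norm w)\<^sup>2"
      by (simp add: q_def linear_cmul[OF lin] power2_eq_square field_simps)
    finally show ?thesis using False by (simp add: field_simps)
  qed
  \<comment> \<open>The residual of the eigenvalue equation is also half the gradient at
    \<open>v\<close> of \<open>q w - l * (norm w)^2\<close>, which is at most 0 on \<open>W\<close>
    and vanishes at \<open>v\<close>.\<close>
  define u where "u = S *v v - l *\<^sub>R v"
  have vW: "v \<in> W" "norm v = 1" using v by auto
  have uW: "u \<in> W"
    unfolding u_def using W vW by (intro subspace_diff subspace_scale) auto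
  \<comment> \<open>Maximality tested at \<open>v + t u\<close>: the term linear in \<open>t\<close>
    must be dominated by the quadratic one for every \<open>t\<close>, which forces
    \<open>u = 0\<close>.\<close>
  have key: "2 * t * (norm u)\<^sup>2 \<le> t\<^sup>2 * (l * (norm u)\<^sup>2 - q u)" for t
  proof -
    have "q (v + t *\<^sub>R u) \<le> l * (norm (v + t *\<^sub>R u))\<^sup>2"
      using vW uW W by (intro qle subspace_add subspace_scale) auto
    moreover have "q (v + t *\<^sub>R u) = q v + 2 * t * (u \<bullet> (S *v v)) + t\<^sup>2 * q u"
    proof -
      have "v \<bullet> (S *v u) = u \<bullet> (S *v v)"
        using inner_mult_left[of S v u] herm by (simp add: inner_commute)
      then show ?thesis
        by (simp add: q_def linear_add[OF lin] linear_cmul[OF lin] inner_add_left inner_add_right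
            power2_eq_square algebra_simps)
    qed
    moreover have "(norm (v + t *\<^sub>R u))\<^sup>2 = 1 + 2 * t * (u \<bullet> v) + t\<^sup>2 * (norm u)\<^sup>2"
    proof -
      have "(norm (v + t *\<^sub>R u))\<^sup>2 = (v + t *\<^sub>R u) \<bullet> (v + t *\<^sub>R u)"
        by (simp add: dot_square_norm)
      also have "\<dots> = v \<bullet> v + 2 * t * (u \<bullet> v) + t\<^sup>2 * (u \<bullet> u)"
        by (simp add: inner_add_left inner_add_right inner_commute power2_eq_square algebra_simps)
      finally show ?thesis using vW by (simp add: dot_square_norm)
    qed
    moreover have "u \<bullet> (S *v v) - l * (u \<bullet> v) = (norm u)\<^sup>2"
      by (simp add: dot_square_norm[symmetric] u_def inner_diff_right inner_diff_left)
    ultimately show ?thesis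
      by (simp add: l_def[symmetric] algebra_simps)
  qed
  have "(norm u)\<^sup>2 = 0"
  proof (rule ccontr)
    assume "(norm u)\<^sup>2 \<noteq> 0"
    \<comment> \<open>The summand 1 keeps \<open>c\<close> positive. With
      \<open>t = (norm u)^2 / c\<close> the quadratic bound \<open>t^2 * c\<close> is only half of
      the linear term.\<close>
    define c where "c = \<bar>l * (norm u)\<^sup>2 - q u\<bar> + 1"
    define t where "t = (norm u)\<^sup>2 / c"
    have pos: "(norm u)\<^sup>2 > 0" "c > 0" "t > 0"
      using \<open>(norm u)\<^sup>2 \<noteq> 0\<close> by (auto simp: c_def t_def add_pos_nonneg intro!: divide_pos_pos)
    have "2 * t * (norm u)\<^sup>2 \<le> t\<^sup>2 * (l * (norm u)\<^sup>2 - q u)" by (rule key)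
    also have "\<dots> \<le> t\<^sup>2 * c" by (intro mult_left_mono) (auto simp: c_def)
    also have "\<dots> = t * (norm u)\<^sup>2" using pos by (simp add: t_def power2_eq_square)
    finally show False using pos by (simp add: mult_le_cancel_left)
  qed
  then have "S *v v = l *\<^sub>R v" by (simp add: u_def)
  with vW show ?thesis by (rule that)
qed

text \<open>Eigenvectors are added one at a time: because \<open>S\<close> is Hermitian, the
  orthogonal complement \<open>W\<close> of those already found is invariant, and while
  \<open>k < CARD('n)\<close> it contains a nonzero vector.\<close>

lemma hermitian_eigenbasis:
  fixes S :: "complex^'n^'n"
  assumes herm: "ctranspose S = S" and "k \<le> CARD('n)"
  shows "\<exists>V. finite V \<and> card V = k \<and> (\<forall>v\<in>V. norm v = 1 \<and> (\<exists>l. S *v v = l *\<^sub>R v)) \<and>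
    (\<forall>v\<in>V. \<forall>w\<in>V. v \<noteq> w \<longrightarrow> hinner v w = 0)"
  using \<open>k \<le> CARD('n)\<close>
proof (induction k)
  case 0
  then show ?case by (intro exI[of _ "{}"]) auto
next
  case (Suc k)
  then obtain V where V: "finite V" "card V = k" "\<And>v. v \<in> V \<Longrightarrow> norm v = 1"
    "\<And>v. v \<in> V \<Longrightarrow> \<exists>l. S *v v = l *\<^sub>R v"
    "\<And>v w. v \<in> V \<Longrightarrow> w \<in> V \<Longrightarrow> v \<noteq> w \<Longrightarrow> hinner v w = 0"
    by auto
  define W where "W = {x. \<forall>v\<in>V. hinner v x = 0}"
  have lin: "linear ((*v) S)"
    by (rule matrix_vector_mul_linear)
  have sub: "subspace W"
    by (auto simp: W_def subspace_def hinner_add_right hinner_smult_right smult_of_real[symmetric])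
       (auto simp: hinner_def)
  have inv: "S *v x \<in> W" if "x \<in> W" for x
    unfolding W_def
  proof safe
    fix v assume v: "v \<in> V"
    obtain l where l: "S *v v = l *\<^sub>R v" using V(4)[OF v] by auto
    have "hinner v (S *v x) = hinner (S *v v) x"
      by (simp add: hinner_mult_left herm)
    also have "\<dots> = 0"
      using that v by (simp add: l smult_of_real[symmetric] hinner_smult_left W_def)
    finally show "hinner v (S *v x) = 0" .
  qed
  \<comment> \<open>Real dimension count: \<open>V\<close> together with \<open>\<i> V\<close> spans
    at most \<open>2 * k\<close> of the \<open>2 * CARD('n)\<close> real dimensions. A vector
    orthogonal to both sets is complex orthogonal to \<open>V\<close>.\<close>
  have "dim (span (V \<union> (*s) \<i> ` V)) \<le> card (V \<union> (*s) \<i> ` V)"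
    using V by (simp add: dim_le_card')
  also have "\<dots> \<le> k + k"
    using V by (metis add_mono card_Un_le card_image_le le_trans order_refl)
  also have "\<dots> < DIM(complex^'n)"
    using Suc.prems by simp
  finally obtain x0 where x0: "x0 \<noteq> 0" "\<And>y. y \<in> span (V \<union> (*s) \<i> ` V) \<Longrightarrow> orthogonal x0 y"
    using orthogonal_to_subspace_exists[of "V \<union> (*s) \<i> ` V"] by auto
  have "x0 \<in> W"
    unfolding W_def hinner_0_iff_inner
    using x0(2)[OF span_base] by (auto simp: orthogonal_def inner_commute[of _ x0])
  from hermitian_eigenvector_in_subspace[OF herm sub inv this x0(1)]
  obtain v l where v: "v \<in> W" "norm v = 1" "S *v v = l *\<^sub>R v" by metis
  have orth: "hinner w v = 0" "hinner v w = 0" if "w \<in> V" for w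
    using v(1) that cnj_hinner[of w v] by (auto simp: W_def)
  have "v \<notin> V"
    using orth[of v] v(2) hinner_self[of v] by auto
  show ?case
    using V v orth \<open>v \<notin> V\<close> by (intro exI[of _ "insert v V"]) auto
qed

theorem hermitian_diagonalization:
  fixes S :: "complex^'n^'n"
  assumes herm: "ctranspose S = S"
  obtains U and l :: "'n \<Rightarrow> real"
  where "ctranspose U ** U = mat 1" "U ** ctranspose U = mat 1"
    "S = U ** diag_mat (\<lambda>j. of_real (l j)) ** ctranspose U"
proof -
  obtain V where V: "finite V" "card V = CARD('n)" "\<And>v. v \<in> V \<Longrightarrow> norm v = 1"
    "\<And>v. v \<in> V \<Longrightarrow> \<exists>l. S *v v = l *\<^sub>R v"
    "\<And>v w. v \<in> V \<Longrightarrow> w \<in> V \<Longrightarrow> v \<noteq> w \<Longrightarrow> hinner v w = 0"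
    using hermitian_eigenbasis[OF herm order_refl] by blast
  obtain e where e: "bij_betw e (UNIV :: 'n set) V"
    using V by (metis finite_same_card_bij finite_class.finite_UNIV)
  have eV: "e i \<in> V" for i using e by (auto simp: bij_betw_def)
  have inj: "e i = e j \<longleftrightarrow> i = j" for i j using e by (auto simp: bij_betw_def inj_on_def)
  obtain l where l: "\<And>i. S *v e i = l i *\<^sub>R e i"
    using V(4)[OF eV] by metis
  define U where "U = (\<chi> i j. e j $ i)"
  have "(ctranspose U ** U) $ i $ j = (mat 1 :: complex^'n^'n) $ i $ j" for i j
  proof -
    have "(ctranspose U ** U) $ i $ j = hinner (e i) (e j)"
      by (simp add: matrix_matrix_mult_def ctranspose_def U_def hinner_def)
    also have "\<dots> = (if i = j then 1 else 0)"
      using V(5)[OF eV eV, of i j] V(3)[OF eV] by (auto simp: inj hinner_self)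
    finally show ?thesis by (simp add: mat_def)
  qed
  then have U1: "ctranspose U ** U = mat 1" by (simp add: vec_eq_iff)
  then have U2: "U ** ctranspose U = mat 1" by (simp add: matrix_left_right_inverse)
  have "S ** U = U ** diag_mat (\<lambda>j. of_real (l j))"
  proof -
    have "(S ** U) $ i $ j = (U ** diag_mat (\<lambda>j. of_real (l j))) $ i $ j" for i j
    proof -
      have "(S ** U) $ i $ j = (S *v e j) $ i"
        by (simp add: matrix_matrix_mult_def matrix_vector_mult_def U_def)
      also have "\<dots> = (U ** diag_mat (\<lambda>j. of_real (l j))) $ i $ j"
        by (simp add: l matrix_matrix_mult_def diag_mat_def U_def if_distrib scaleR_conv_of_real[where 'a=complex]
            mult.commute cong: if_cong)
      finally show ?thesis .
    qed
    then show ?thesis by (simp add: vec_eq_iff)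
  qed
  then have "S ** U ** ctranspose U = U ** diag_mat (\<lambda>j. of_real (l j)) ** ctranspose U"
    by simp
  then have "S = U ** diag_mat (\<lambda>j. of_real (l j)) ** ctranspose U"
    by (simp add: matrix_mul_assoc[symmetric] U2)
  with U1 U2 show ?thesis by (rule that)
qed

section \<open>Linear images of Gaussian measures\<close>

text \<open>The adjoint \<open>Q'\<close> embeds \<open>'b\<close> isometrically. An isometry
  \<open>f\<close> from \<open>'a\<close> onto the orthogonal complement of its range completes it
  to an isometry \<open>U\<close> of the whole space, and \<open>Q\<close> vanishes on that
  complement. Writing the domain as a product provides a space \<open>'a\<close> of exactly the
  complementary dimension.\<close>

lemma coisometry_factors_through_projection:
  fixes Q :: "'a::euclidean_space \<times> 'b::euclidean_space \<Rightarrow> 'b" and Q' :: "'b \<Rightarrow> 'a \<times> 'b"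
  assumes Q: "linear Q" and Q': "linear Q'"
    and adj: "\<And>x y. Q x \<bullet> y = x \<bullet> Q' y"
    and one: "\<And>y. Q (Q' y) = y"
  obtains U :: "'a \<times> 'b \<Rightarrow> 'a \<times> 'b"
  where "linear U" "\<And>x. norm (U x) = norm x" "\<And>x. Q (U x) = snd x"
proof -
  interpret Q: linear Q by fact
  interpret Q': linear Q' by fact
  let ?R = "range Q'"
  let ?N = "{x. \<forall>y\<in>?R. orthogonal y x}"
  have nQ': "norm (Q' y) = norm y" for y
    by (simp add: norm_eq_sqrt_inner adj[symmetric] one)
  have sub: "subspace ?R" "subspace ?N"
    using linear_subspace_image[OF Q' subspace_UNIV]
    by (auto simp: subspace_def orthogonal_def inner_add_right)
  have "inj Q'" by (metis injI one)
  then have "dim ?R = DIM('b)"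
    by (simp add: dim_image_eq[OF Q'] inj_on_subset)
  moreover have "dim ?N + dim ?R = DIM('a \<times> 'b)"
    using dim_subspace_orthogonal_to_vectors[of ?R UNIV] sub by simp
  ultimately have dim: "dim (UNIV :: 'a set) = dim ?N" by simp
  obtain f :: "'a \<Rightarrow> 'a \<times> 'b" where f: "linear f" "range f = ?N" "\<And>x. norm (f x) = norm x"
  proof (rule isometries_subspaces[OF subspace_UNIV sub(2) dim])
    fix f :: "'a \<Rightarrow> 'a \<times> 'b"
    assume "linear f" "range f = ?N" "\<And>x. x \<in> UNIV \<Longrightarrow> norm (f x) = norm x"
    then show thesis using that by blast
  qed
  interpret f: linear f by fact
  define U where "U x = f (fst x) + Q' (snd x)" for x
  have "linear U"
    by (auto simp: U_def f.add f.scaleR Q'.add Q'.scaleR algebra_simps intro!: linearI)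
  moreover have fN: "orthogonal (Q' y) (f x)" for x y
    using f(2) by auto
  have "norm (U x) = norm x" for x
  proof -
    have "(norm (U x))\<^sup>2 = (norm (f (fst x)))\<^sup>2 + (norm (Q' (snd x)))\<^sup>2"
      unfolding U_def using fN[of "snd x" "fst x"] 
      by (intro norm_add_Pythagorean) (simp add: orthogonal_commute)
    also have "\<dots> = (norm (fst x))\<^sup>2 + (norm (snd x))\<^sup>2"
      by (simp only: f nQ')
    also have "\<dots> = (norm x)\<^sup>2"
      by (simp add: norm_prod_def)
    finally show ?thesis by simp
  qed
  moreover have "Q (U x) = snd x" for x
  proof -
    \<comment> \<open>The right-hand side pairs the complement with the range of \<open>Q'\<close>,
      so \<open>Q\<close> annihilates the range of \<open>f\<close>.\<close>
    have "Q (f (fst x)) \<bullet> Q (f (fst x)) = f (fst x) \<bullet> Q' (Q (f (fst x)))"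
      by (rule adj)
    also have "\<dots> = 0"
      using fN[of "Q (f (fst x))" "fst x"] by (simp add: orthogonal_def inner_commute)
    finally show ?thesis by (simp add: U_def Q.add one)
  qed
  ultimately show ?thesis by (rule that)
qed

text \<open>Isometry invariance allows \<open>U\<close> to be inserted before \<open>Q\<close>, and
  \<open>Q\<close> after \<open>U\<close> is the second projection, whose law is a marginal of
  \<open>gauss v \<Otimes>\<^sub>M gauss v\<close>.\<close>

lemma gauss_distr_coisometry:
  fixes Q :: "'a::euclidean_space \<times> 'b::euclidean_space \<Rightarrow> 'b" and Q' :: "'b \<Rightarrow> 'a \<times> 'b"
  assumes v: "v > 0" and Q: "linear Q" and Q': "linear Q'"
    and adj: "\<And>x y. Q x \<bullet> y = x \<bullet> Q' y"
    and one: "\<And>y. Q (Q' y) = y"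
  shows "distr (gauss v) borel Q = gauss v"
proof -
  obtain U :: "'a \<times> 'b \<Rightarrow> 'a \<times> 'b"
    where U: "linear U" "\<And>x. norm (U x) = norm x" "\<And>x. Q (U x) = snd x"
    using coisometry_factors_through_projection[OF Q Q' adj one] by metis
  have [measurable]: "Q \<in> borel_measurable borel" "U \<in> borel_measurable borel"
    by (rule borel_measurable_linear[OF Q], rule borel_measurable_linear[OF U(1)])
  interpret G: prob_space "gauss v :: 'a measure" by (rule prob_space_gauss[OF v])
  interpret G': prob_space "gauss v :: 'b measure" by (rule prob_space_gauss[OF v])
  have "distr (gauss v) borel Q = distr (distr (gauss v) borel U) borel Q"
    by (simp add: gauss_distr_isometry[OF U(1,2)])
  also have "\<dots> = distr (gauss v :: ('a \<times> 'b) measure) borel snd"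
    by (subst distr_distr) (auto simp: o_def U(3))
  also have "\<dots> = distr (gauss v \<Otimes>\<^sub>M gauss v :: ('a \<times> 'b) measure) borel snd"
    by (simp add: gauss_prod[OF v])
  also have "\<dots> = gauss v"
  proof (rule measure_eqI)
    fix B assume "B \<in> sets (distr (gauss v \<Otimes>\<^sub>M gauss v :: ('a \<times> 'b) measure) borel snd)"
    then have [measurable]: "B \<in> sets borel" by simp
    have "snd -` B \<inter> space (gauss v \<Otimes>\<^sub>M gauss v :: ('a \<times> 'b) measure) = UNIV \<times> B"
      by (auto simp: space_pair_measure)
    then show "emeasure (distr (gauss v \<Otimes>\<^sub>M gauss v :: ('a \<times> 'b) measure) borel snd) B = emeasure (gauss v) B"
      using G.emeasure_space_1
      by (subst emeasure_distr) (auto simp: G'.emeasure_pair_measure_Times)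
  qed simp
  finally show ?thesis .
qed

text \<open>\<open>D\<close> is a scaling of the real coordinates, of Jacobian
  \<open>prod c Basis\<close>, followed by an isometry, of Jacobian 1. The left inverse
  \<open>E\<close> expresses the old density at the new point.\<close>

lemma gauss_distr_diag_isometry:
  fixes U :: "'a::euclidean_space \<Rightarrow> 'a" and c :: "'a \<Rightarrow> real"
  assumes U: "linear U" "\<And>x. norm (U x) = norm x"
    and c: "\<And>b. b \<in> Basis \<Longrightarrow> c b > 0"
    and D: "\<And>x. D x = U (\<Sum>b\<in>Basis. (c b * (x \<bullet> b)) *\<^sub>R b)"
    and E: "linear E" "\<And>x. E (D x) = x"
  shows "distr (gauss 1) borel D =
    density lborel (\<lambda>y. ennreal (exp (- (norm (E y))\<^sup>2) / (sqrt pi ^ DIM('a) * prod c Basis)))"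
proof -
  define T where "T x = (\<Sum>b\<in>Basis. (c b * (x \<bullet> b)) *\<^sub>R b)" for x
  define h where "h y = ennreal (exp (- (norm (E y))\<^sup>2) / sqrt pi ^ DIM('a))" for y
  let ?C = "prod c Basis"
  have C: "?C > 0" using c by (intro prod_pos) auto
  have lT: "linear T"
    by (auto simp: T_def inner_simps algebra_simps sum.distrib scaleR_sum_right intro!: linearI)
  have DT: "D = U \<circ> T" by (auto simp: D T_def)
  have [measurable]: "T \<in> borel_measurable borel" "U \<in> borel_measurable borel" "E \<in> borel_measurable borel"
    by (intro borel_measurable_linear lT U E)+
  have [measurable]: "D \<in> borel_measurable borel" unfolding DT by measurable
  have [measurable]: "h \<in> borel_measurable borel" unfolding h_def by measurable
  have "(lborel :: 'a measure) = density (distr lborel borel T) (\<lambda>_. ennreal (\<Prod>b\<in>Basis. \<bar>c b\<bar>))"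
    unfolding T_def using c lborel_affine_euclidean[of c "0::'a"] by fastforce
  also have "(\<Prod>b\<in>Basis. \<bar>c b\<bar>) = ?C"
    using c by (intro prod.cong) (auto simp: abs_of_pos)
  finally have "density lborel (\<lambda>_. ennreal (1 / ?C))
      = density (density (distr lborel borel T) (\<lambda>_. ennreal ?C)) (\<lambda>_. ennreal (1 / ?C))"
    by simp
  also have "\<dots> = distr lborel borel T"
  proof -
    have "ennreal ?C * ennreal (1 / ?C) = ennreal (?C * (1 / ?C))"
      using C by (intro ennreal_mult[symmetric]) auto
    also have "?C * (1 / ?C) = 1"
      using less_imp_neq[OF C] by (metis nonzero_mult_div_cancel_left times_divide_eq_right mult_1_right)
    finally have "ennreal ?C * ennreal (1 / ?C) = 1" by simp
    then show ?thesis by (subst density_density_eq) (auto simp: density_1)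
  qed
  finally have T': "distr lborel borel T = density lborel (\<lambda>_. ennreal (1 / ?C))" by simp
  have "distr lborel borel D = distr (distr lborel borel T) borel U"
    by (subst distr_distr) (auto simp: DT)
  also have "\<dots> = density (distr lborel borel U) (\<lambda>_. ennreal (1 / ?C))"
    unfolding T' by (subst density_distr) auto
  finally have D': "distr lborel borel D = density lborel (\<lambda>_. ennreal (1 / ?C))"
    by (simp add: lborel_distr_isometry[OF U])
  have "distr (gauss 1) borel D = distr (density lborel (\<lambda>x. h (D x))) borel D"
    by (simp add: gauss_def h_def E)
  also have "\<dots> = density (distr lborel borel D) h"
    by (subst density_distr) auto
  also have "\<dots> = density lborel (\<lambda>y. ennreal (1 / ?C) * h y)"
    unfolding D' by (subst density_density_eq) auto
  also have "(\<lambda>y. ennreal (1 / ?C) * h y)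
      = (\<lambda>y. ennreal (exp (- (norm (E y))\<^sup>2) / (sqrt pi ^ DIM('a) * ?C)))"
    using C by (auto simp: h_def ennreal_mult[symmetric] mult.commute)
  finally show ?thesis .
qed

lemma gauss_eq_distr_scaleR:
  assumes v: "v > 0"
  shows "(gauss v :: 'a::euclidean_space measure) = distr (gauss 1) borel (\<lambda>x. sqrt v *\<^sub>R x)"
proof -
  have sc: "(\<Sum>b\<in>Basis. (a * (x \<bullet> b)) *\<^sub>R b) = a *\<^sub>R x" for a and x :: 'a
    using euclidean_representation[of "a *\<^sub>R x"] by simp
  have "distr (gauss 1) borel (\<lambda>x. sqrt v *\<^sub>R x) = density lborel (\<lambda>y::'a.
      ennreal (exp (- (norm ((1 / sqrt v) *\<^sub>R y))\<^sup>2) / (sqrt pi ^ DIM('a) * (\<Prod>b\<in>(Basis::'a set). sqrt v))))"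
    using v by (intro gauss_distr_diag_isometry[where U="\<lambda>x. x" and c="\<lambda>_. sqrt v"])
      (auto simp: sc linear_scale_self intro!: linearI simp: algebra_simps)
  also have "\<dots> = gauss v"
    using v by (simp add: gauss_def power_divide real_sqrt_mult power_mult_distrib)
  finally show ?thesis by simp
qed

lemma distr_PiM:
  assumes "finite I" and M: "\<And>i. prob_space (M i)" and f [measurable]: "\<And>i. f i \<in> measurable (M i) (N i)"
  shows "(\<Pi>\<^sub>M i\<in>I. distr (M i) (N i) (f i)) = distr (Pi\<^sub>M I M) (Pi\<^sub>M I N) (\<lambda>z. \<lambda>i\<in>I. f i (z i))"
proof -
  interpret M: product_prob_space M
    by (simp add: M prob_space_imp_sigma_finite product_prob_space_axioms_def product_prob_space_def product_sigma_finite_def)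
  have D: "prob_space (distr (M i) (N i) (f i))" for i
    by (intro prob_space.prob_space_distr M f)
  interpret D: product_sigma_finite "\<lambda>i. distr (M i) (N i) (f i)"
    by (rule product_sigma_finite.intro) (intro prob_space_imp_sigma_finite D)
  have [measurable]: "(\<lambda>z. \<lambda>i\<in>I. f i (z i)) \<in> measurable (Pi\<^sub>M I M) (Pi\<^sub>M I N)"
    by (intro measurable_restrict measurable_compose[OF measurable_component_singleton]) auto
  show ?thesis
  proof (rule D.PiM_eqI[symmetric, OF \<open>finite I\<close>])
    fix A assume "\<And>i. i \<in> I \<Longrightarrow> A i \<in> sets (distr (M i) (N i) (f i))"
    then have A [measurable]: "\<And>i. i \<in> I \<Longrightarrow> A i \<in> sets (N i)" by simp
    have "(\<lambda>z. \<lambda>i\<in>I. f i (z i)) -` Pi\<^sub>E I A \<inter> space (Pi\<^sub>M I M) = Pi\<^sub>E I (\<lambda>i. f i -` A i \<inter> space (M i))"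
      by (auto simp: space_PiM PiE_def Pi_def extensional_def)
    moreover have "Pi\<^sub>E I A \<in> sets (Pi\<^sub>M I N)"
      using A \<open>finite I\<close> by (intro sets_PiM_I_finite) auto
    ultimately have "emeasure (distr (Pi\<^sub>M I M) (Pi\<^sub>M I N) (\<lambda>z. \<lambda>i\<in>I. f i (z i))) (Pi\<^sub>E I A)
       = emeasure (Pi\<^sub>M I M) (Pi\<^sub>E I (\<lambda>i. f i -` A i \<inter> space (M i)))"
      by (subst emeasure_distr) auto
    also have "\<dots> = (\<Prod>i\<in>I. emeasure (M i) (f i -` A i \<inter> space (M i)))"
      using A \<open>finite I\<close> by (intro M.emeasure_PiM) auto
    also have "\<dots> = (\<Prod>i\<in>I. emeasure (distr (M i) (N i) (f i)) (A i))"
      using A by (intro prod.cong) (auto simp: emeasure_distr)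
    finally show "emeasure (distr (Pi\<^sub>M I M) (Pi\<^sub>M I N) (\<lambda>z. \<lambda>i\<in>I. f i (z i))) (Pi\<^sub>E I A)
       = (\<Prod>i\<in>I. emeasure (distr (M i) (N i) (f i)) (A i))" .
  qed (auto intro!: sets_PiM_cong)
qed

text \<open>Independence makes the joint law a product of images, which is the image of a product;
  the independent sources then assemble into a single isotropic Gaussian vector.\<close>

lemma distr_vec_indep:
  fixes Z :: "'i::finite \<Rightarrow> 'w \<Rightarrow> 'a::euclidean_space" and f :: "'i \<Rightarrow> 'b::euclidean_space \<Rightarrow> 'a"
  assumes M: "prob_space M" and v: "v > 0"
    and indep: "prob_space.indep_vars M (\<lambda>_. borel) Z UNIV"
    and law: "\<And>i. distr M borel (Z i) = distr (gauss v) borel (f i)"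
    and f [measurable]: "\<And>i. f i \<in> borel_measurable borel"
  shows "distr M borel (\<lambda>\<omega>. \<chi> i. Z i \<omega>) = distr (gauss v) borel (\<lambda>z. \<chi> i. f i (z $ i))"
proof -
  interpret prob_space M by fact
  have Z [measurable]: "Z i \<in> borel_measurable M" for i
    using indep by (auto simp: indep_vars_def2)
  have [measurable]: "(\<lambda>\<omega> i. Z i \<omega>) \<in> measurable M (\<Pi>\<^sub>M i\<in>UNIV. borel)"
    using measurable_restrict[of UNIV Z M "\<lambda>_. borel"] by (simp add: restrict_def)
  have [measurable]: "(\<lambda>z i. f i (z i)) \<in> measurable (\<Pi>\<^sub>M i\<in>UNIV. gauss v) (\<Pi>\<^sub>M i\<in>UNIV. borel)"
    using measurable_restrict[of UNIV "\<lambda>i z. f i (z i)" "\<Pi>\<^sub>M i\<in>UNIV. gauss v" "\<lambda>_. borel"]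
    by (simp add: restrict_def)
  have [measurable]: "(\<lambda>z. \<chi> i. z i) \<in> borel_measurable (\<Pi>\<^sub>M i\<in>(UNIV::'i set). (borel :: 'c::euclidean_space measure))"
    by (intro borel_measurable_vec_lambda) auto
  have [measurable]: "(\<lambda>z. \<chi> i. z i) \<in> borel_measurable (\<Pi>\<^sub>M i\<in>(UNIV::'i set). (gauss v :: 'b measure))"
    by (intro borel_measurable_vec_lambda) auto
  have [measurable]: "(\<lambda>z::'b^'i. \<chi> i. f i (z $ i)) \<in> borel_measurable borel"
    by (intro borel_measurable_vec_lambda measurable_compose[OF _ f] borel_measurable_linear bounded_linear.linear bounded_linear_vec_nth)
  have "distr M borel (\<lambda>\<omega>. \<chi> i. Z i \<omega>)
      = distr (distr M (\<Pi>\<^sub>M i\<in>UNIV. borel) (\<lambda>\<omega>. \<lambda>i\<in>UNIV. Z i \<omega>)) borel (\<lambda>z. \<chi> i. z i)"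
    by (subst distr_distr) (auto simp: o_def restrict_def)
  also have "distr M (\<Pi>\<^sub>M i\<in>UNIV. borel) (\<lambda>\<omega>. \<lambda>i\<in>UNIV. Z i \<omega>) = (\<Pi>\<^sub>M i\<in>UNIV. distr (gauss v) borel (f i))"
    using indep by (subst (asm) indep_vars_iff_distr_eq_PiM) (auto simp: law)
  also have "\<dots> = distr (\<Pi>\<^sub>M i\<in>UNIV. gauss v) (\<Pi>\<^sub>M i\<in>UNIV. borel) (\<lambda>z. \<lambda>i\<in>UNIV. f i (z i))"
    by (intro distr_PiM prob_space_gauss v) auto
  also have "distr \<dots> borel (\<lambda>z. \<chi> i. z i) = distr (\<Pi>\<^sub>M i\<in>UNIV. gauss v) borel (\<lambda>z. \<chi> i. f i (z i))"
    by (subst distr_distr) (auto simp: o_def restrict_def)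
  also have "\<dots> = distr (distr (\<Pi>\<^sub>M i\<in>UNIV. gauss v) borel (\<lambda>z. \<chi> i. z i)) borel (\<lambda>z. \<chi> i. f i (z $ i))"
    by (subst distr_distr) (auto simp: o_def)
  finally show ?thesis by (simp add: gauss_vec[OF v])
qed

section \<open>Mutual information of additive noise channels\<close>

text \<open>\<open>entropy\<close> is minus a Kullback-Leibler divergence from the reference
  measure; with Lebesgue measure as reference it is differential entropy.\<close>

lemma prob_space_entropy_density:
  assumes J: "prob_space J" and X: "distr J lborel X = density lborel f"
    and "b > 1" and [measurable]: "f \<in> borel_measurable borel" and f: "\<And>y. 0 \<le> f y"
  shows "prob_space.entropy J b lborel X = - (\<integral>y. log b (f y) \<partial>density lborel f)"
proof -
  interpret prob_space J by fact
  have "(\<integral>y. log b (f y) \<partial>density lborel f) = (\<integral>y. f y * log b (f y) \<partial>lborel)"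
    by (subst integral_real_density) (auto simp: f)
  also have "\<dots> = KL_divergence b lborel (density lborel f)"
    using \<open>b > 1\<close> f by (subst lborel.KL_density) auto
  finally show ?thesis by (simp add: entropy_def X)
qed

text \<open>For fixed \<open>x\<close> the output is the noise translated by
  \<open>\<phi> x\<close>, and Lebesgue measure ignores the translation. Keeping \<open>P\<close>
  itself as the reference in the first factor admits signals without a density.\<close>

lemma additive_noise_density:
  fixes P :: "'a::topological_space measure" and g :: "'b::euclidean_space \<Rightarrow> real" and \<phi> :: "'a \<Rightarrow> 'b"
  assumes P: "prob_space P" and sets_P [measurable_cong]: "sets P = sets borel"
    and [measurable]: "\<phi> \<in> borel_measurable borel" "g \<in> borel_measurable borel"
    and "prob_space (density lborel g)"
  shows "distr (P \<Otimes>\<^sub>M density lborel g) (borel \<Otimes>\<^sub>M borel) (\<lambda>(x, w). (x, \<phi> x + w))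
    = density (P \<Otimes>\<^sub>M lborel) (\<lambda>(x, y). g (y - \<phi> x))"
proof (rule measure_eqI)
  interpret P: prob_space P by fact
  interpret G: prob_space "density lborel g" by fact
  interpret PG: pair_sigma_finite P lborel by standard
  fix A assume "A \<in> sets (distr (P \<Otimes>\<^sub>M density lborel g) (borel \<Otimes>\<^sub>M borel) (\<lambda>(x, w). (x, \<phi> x + w)))"
  then have [measurable]: "A \<in> sets (borel \<Otimes>\<^sub>M borel)" by simp
  have "emeasure (distr (P \<Otimes>\<^sub>M density lborel g) (borel \<Otimes>\<^sub>M borel) (\<lambda>(x, w). (x, \<phi> x + w))) A
      = (\<integral>\<^sup>+z. indicator A z \<partial>distr (P \<Otimes>\<^sub>M density lborel g) (borel \<Otimes>\<^sub>M borel) (\<lambda>(x, w). (x, \<phi> x + w)))"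
    by simp
  also have "\<dots> = (\<integral>\<^sup>+z. indicator A (fst z, \<phi> (fst z) + snd z) \<partial>(P \<Otimes>\<^sub>M density lborel g))"
    by (subst nn_integral_distr) (auto simp: case_prod_beta)
  also have "\<dots> = (\<integral>\<^sup>+x. \<integral>\<^sup>+w. indicator A (x, \<phi> x + w) \<partial>density lborel g \<partial>P)"
    by (subst G.nn_integral_fst[symmetric]) auto
  also have "\<dots> = (\<integral>\<^sup>+x. \<integral>\<^sup>+w. ennreal (g ((\<phi> x + w) - \<phi> x)) * indicator A (x, \<phi> x + w) \<partial>lborel \<partial>P)"
    by (intro nn_integral_cong) (auto simp: nn_integral_density)
  also have "\<dots> = (\<integral>\<^sup>+x. \<integral>\<^sup>+y. ennreal (g (y - \<phi> x)) * indicator A (x, y) \<partial>lborel \<partial>P)"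
  proof (rule nn_integral_cong)
    fix x
    have "(\<integral>\<^sup>+y. ennreal (g (y - \<phi> x)) * indicator A (x, y) \<partial>lborel)
        = (\<integral>\<^sup>+y. ennreal (g (y - \<phi> x)) * indicator A (x, y) \<partial>distr lborel borel ((+) (\<phi> x)))"
      by (simp add: lborel_distr_plus)
    also have "\<dots> = (\<integral>\<^sup>+w. ennreal (g ((\<phi> x + w) - \<phi> x)) * indicator A (x, \<phi> x + w) \<partial>lborel)"
      by (subst nn_integral_distr) auto
    finally show "(\<integral>\<^sup>+w. ennreal (g ((\<phi> x + w) - \<phi> x)) * indicator A (x, \<phi> x + w) \<partial>lborel)
        = (\<integral>\<^sup>+y. ennreal (g (y - \<phi> x)) * indicator A (x, y) \<partial>lborel)" by simp
  qed
  also have "\<dots> = (\<integral>\<^sup>+z. ennreal (g (snd z - \<phi> (fst z))) * indicator A z \<partial>(P \<Otimes>\<^sub>M lborel))"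
    by (subst lborel.nn_integral_fst[symmetric]) auto
  also have "\<dots> = emeasure (density (P \<Otimes>\<^sub>M lborel) (\<lambda>(x, y). g (y - \<phi> x))) A"
    by (subst emeasure_density) (auto simp: case_prod_beta intro!: sets_pair_measure_cong)
  finally show "emeasure (distr (P \<Otimes>\<^sub>M density lborel g) (borel \<Otimes>\<^sub>M borel) (\<lambda>(x, w). (x, \<phi> x + w))) A
     = emeasure (density (P \<Otimes>\<^sub>M lborel) (\<lambda>(x, y). g (y - \<phi> x))) A" .
qed (simp add: sets_P cong: sets_pair_measure_cong)

text \<open>Joint law and product of marginals both have positive densities with respect to the
  common reference \<open>P \<Otimes>\<^sub>M lborel\<close>, so the divergence is the mean
  logarithm of their quotient. The two integrability hypotheses permit splitting it into two
  entropies.\<close>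

lemma mutual_information_additive_noise:
  fixes P :: "'a::topological_space measure" and f g :: "'b::euclidean_space \<Rightarrow> real" and \<phi> :: "'a \<Rightarrow> 'b"
  assumes P: "prob_space P" and sets_P [measurable_cong]: "sets P = sets borel"
    and [measurable]: "\<phi> \<in> borel_measurable borel" "f \<in> borel_measurable borel" "g \<in> borel_measurable borel"
    and pos: "\<And>y. f y > 0" "\<And>y. g y > 0"
    and G: "prob_space (density lborel g)"
    and Q: "distr (P \<Otimes>\<^sub>M density lborel g) borel (\<lambda>(x, w). \<phi> x + w) = density lborel f"
    and int_g: "integrable (density lborel g) (\<lambda>w. log b (g w))"
    and int_f: "integrable (density lborel f) (\<lambda>y. log b (f y))"
    and b: "b > 1"
    and J: "J = distr (P \<Otimes>\<^sub>M density lborel g) (borel \<Otimes>\<^sub>M borel) (\<lambda>(x, w). (x, \<phi> x + w))"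
  shows "prob_space.mutual_information J b borel borel fst snd
      = prob_space.entropy J b lborel snd + (\<integral>w. log b (g w) \<partial>density lborel g)"
    and "prob_space.entropy J b lborel snd = - (\<integral>y. log b (f y) \<partial>density lborel f)"
proof -
  let ?G = "density lborel g"
  interpret P: prob_space P by fact
  interpret G: prob_space ?G by fact
  interpret PG: pair_prob_space P ?G by standard
  interpret PL: pair_sigma_finite P lborel by standard
  have J': "prob_space J"
    unfolding J by (intro PG.prob_space_distr) auto
  interpret J: prob_space J by fact
  have [measurable_cong]: "sets J = sets (borel \<Otimes>\<^sub>M borel)" by (simp add: J)
  have "distr J lborel snd = distr J borel snd"
    by (rule distr_cong) auto
  also have "\<dots> = distr (P \<Otimes>\<^sub>M ?G) borel (\<lambda>(x, w). \<phi> x + w)"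
    unfolding J by (subst distr_distr) (auto simp: o_def case_prod_beta')
  also note Q
  finally have snd_l: "distr J lborel snd = density lborel f" .
  have snd_b: "distr J borel snd = density lborel f"
    unfolding J Q[symmetric] by (subst distr_distr) (auto simp: o_def case_prod_beta')
  have "prob_space (density lborel f)"
    unfolding snd_b[symmetric] by (intro J.prob_space_distr) auto
  then interpret F: prob_space "density lborel f" .
  have fst_b: "distr J borel fst = P"
  proof -
    have "distr J borel fst = distr (P \<Otimes>\<^sub>M ?G) P fst"
      unfolding J by (subst distr_distr) (auto simp: o_def case_prod_beta sets_P intro!: distr_cong)
    also have "\<dots> = P"
    proof (rule measure_eqI)
      fix A assume "A \<in> sets (distr (P \<Otimes>\<^sub>M ?G) P fst)"
      then have [measurable]: "A \<in> sets P" by simp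
      then have "fst -` A \<inter> space (P \<Otimes>\<^sub>M ?G) = A \<times> space ?G"
        using sets.sets_into_space[of A P] by (auto simp: space_pair_measure)
      then show "emeasure (distr (P \<Otimes>\<^sub>M ?G) P fst) A = emeasure P A"
        using G.emeasure_space_1 by (subst emeasure_distr) (auto simp: G.emeasure_pair_measure_Times)
    qed simp
    finally show ?thesis .
  qed
  have PQ: "P \<Otimes>\<^sub>M density lborel f = density (P \<Otimes>\<^sub>M lborel) (\<lambda>z. ennreal (f (snd z)))"
  proof -
    have "density P (\<lambda>_. 1) \<Otimes>\<^sub>M density lborel f = density (P \<Otimes>\<^sub>M lborel) (\<lambda>(x, y). 1 * ennreal (f y))"
      by (intro pair_measure_density) (auto intro: F.sigma_finite_measure_axioms lborel.sigma_finite_measure_axioms)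
    then show ?thesis by (simp add: density_1 case_prod_beta')
  qed
  have J_dens: "J = density (P \<Otimes>\<^sub>M lborel) (\<lambda>(x, y). g (y - \<phi> x))"
    unfolding J by (intro additive_noise_density assms) measurable
  have "J.mutual_information b borel borel fst snd = KL_divergence b (P \<Otimes>\<^sub>M density lborel f) J"
    unfolding J.mutual_information_def fst_b snd_b by (simp add: distr_id2 J)
  also have "\<dots> = KL_divergence b (density (P \<Otimes>\<^sub>M lborel) (\<lambda>z. f (snd z)))
      (density (P \<Otimes>\<^sub>M lborel) (\<lambda>z. g (snd z - \<phi> (fst z))))"
    unfolding J_dens PQ by (simp add: case_prod_beta')
  also have "\<dots> = (\<integral>z. g (snd z - \<phi> (fst z)) * log b (g (snd z - \<phi> (fst z)) / f (snd z)) \<partial>(P \<Otimes>\<^sub>M lborel))"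
    using b pos by (intro PL.KL_density_density) (auto simp: less_imp_le less_imp_neq[symmetric])
  also have "\<dots> = (\<integral>z. log b (g (snd z - \<phi> (fst z)) / f (snd z)) \<partial>J)"
    unfolding J_dens case_prod_beta' using pos
    by (subst integral_real_density) (auto simp: less_imp_le)
  \<comment> \<open>In the coordinates \<open>(x, w)\<close> the argument of \<open>g\<close> is the
    noise and that of \<open>f\<close> is the output, so each logarithm can be integrated against
    its own law.\<close>
  also have "\<dots> = (\<integral>z. log b (g (snd z) / f (\<phi> (fst z) + snd z)) \<partial>(P \<Otimes>\<^sub>M ?G))"
    unfolding J by (subst integral_distr) (auto simp: case_prod_beta)
  also have "\<dots> = (\<integral>z. log b (g (snd z)) - log b (f (\<phi> (fst z) + snd z)) \<partial>(P \<Otimes>\<^sub>M ?G))"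
    using pos by (intro Bochner_Integration.integral_cong refl log_divide_pos)
  also have "\<dots> = (\<integral>w. log b (g w) \<partial>?G) - (\<integral>y. log b (f y) \<partial>density lborel f)"
  proof (subst Bochner_Integration.integral_diff)
    have snd: "distr (P \<Otimes>\<^sub>M ?G) borel snd = ?G"
    proof (rule measure_eqI)
      fix A assume "A \<in> sets (distr (P \<Otimes>\<^sub>M ?G) borel snd)"
      then have [measurable]: "A \<in> sets borel" by simp
      then have "snd -` A \<inter> space (P \<Otimes>\<^sub>M ?G) = space P \<times> A"
        by (auto simp: space_pair_measure)
      then show "emeasure (distr (P \<Otimes>\<^sub>M ?G) borel snd) A = emeasure ?G A"
        using P.emeasure_space_1 by (subst emeasure_distr) (auto simp: G.emeasure_pair_measure_Times)
    qed simp
    have "integrable (distr (P \<Otimes>\<^sub>M ?G) borel snd) (\<lambda>w. log b (g w))"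
      unfolding snd by (rule int_g)
    then show "integrable (P \<Otimes>\<^sub>M ?G) (\<lambda>z. log b (g (snd z)))"
      by (subst (asm) integrable_distr_eq) auto
    have "integrable (distr (P \<Otimes>\<^sub>M ?G) borel (\<lambda>(x, w). \<phi> x + w)) (\<lambda>y. log b (f y))"
      unfolding Q by (rule int_f)
    then show "integrable (P \<Otimes>\<^sub>M ?G) (\<lambda>z. log b (f (\<phi> (fst z) + snd z)))"
      by (subst (asm) integrable_distr_eq) (auto simp: case_prod_beta)
    have "(\<integral>w. log b (g w) \<partial>?G) = (\<integral>w. log b (g w) \<partial>distr (P \<Otimes>\<^sub>M ?G) borel snd)"
      unfolding snd ..
    also have "\<dots> = (\<integral>z. log b (g (snd z)) \<partial>(P \<Otimes>\<^sub>M ?G))"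
      by (subst integral_distr) auto
    finally have 1: "(\<integral>z. log b (g (snd z)) \<partial>(P \<Otimes>\<^sub>M ?G)) = (\<integral>w. log b (g w) \<partial>?G)" by simp
    have "(\<integral>y. log b (f y) \<partial>density lborel f)
        = (\<integral>y. log b (f y) \<partial>distr (P \<Otimes>\<^sub>M ?G) borel (\<lambda>(x, w). \<phi> x + w))"
      unfolding Q ..
    also have "\<dots> = (\<integral>z. log b (f (\<phi> (fst z) + snd z)) \<partial>(P \<Otimes>\<^sub>M ?G))"
      by (subst integral_distr) (auto simp: case_prod_beta)
    finally show "(\<integral>z. log b (g (snd z)) \<partial>(P \<Otimes>\<^sub>M ?G)) - (\<integral>z. log b (f (\<phi> (fst z) + snd z)) \<partial>(P \<Otimes>\<^sub>M ?G))
        = (\<integral>w. log b (g w) \<partial>?G) - (\<integral>y. log b (f y) \<partial>density lborel f)"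
      using 1 by simp
  qed
  finally have MI: "J.mutual_information b borel borel fst snd
      = (\<integral>w. log b (g w) \<partial>?G) - (\<integral>y. log b (f y) \<partial>density lborel f)" .
  show ent: "J.entropy b lborel snd = - (\<integral>y. log b (f y) \<partial>density lborel f)"
    using pos b by (intro prob_space_entropy_density J' snd_l) (auto simp: less_imp_le)
  show "J.mutual_information b borel borel fst snd = J.entropy b lborel snd + (\<integral>w. log b (g w) \<partial>?G)"
    by (simp add: MI ent)
qed

section \<open>Conditional laws: construction from independence, and uniqueness\<close>

lemma indep_rvs_distr_pair:
  assumes M: "prob_space M" and ind: "indep_rvs M S U T V"
  shows "distr M (S \<Otimes>\<^sub>M T) (\<lambda>\<omega>. (U \<omega>, V \<omega>)) = distr M S U \<Otimes>\<^sub>M distr M T V"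
proof -
  interpret prob_space M by fact
  have [measurable]: "U \<in> measurable M S" "V \<in> measurable M T"
    and i: "indep_set {U -` A \<inter> space M | A. A \<in> sets S} {V -` B \<inter> space M | B. B \<in> sets T}"
    using ind by (auto simp: indep_rvs_def)
  interpret U: prob_space "distr M S U" by (rule prob_space_distr) auto
  interpret V: prob_space "distr M T V" by (rule prob_space_distr) auto
  show ?thesis
  proof (rule pair_measure_eqI[symmetric])
    fix A B assume "A \<in> sets (distr M S U)" "B \<in> sets (distr M T V)"
    then have [measurable]: "A \<in> sets S" "B \<in> sets T" by simp_all
    have "(\<lambda>\<omega>. (U \<omega>, V \<omega>)) -` (A \<times> B) \<inter> space M = (U -` A \<inter> space M) \<inter> (V -` B \<inter> space M)"
      by auto
    then have "emeasure (distr M (S \<Otimes>\<^sub>M T) (\<lambda>\<omega>. (U \<omega>, V \<omega>))) (A \<times> B)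
        = ennreal (prob ((U -` A \<inter> space M) \<inter> (V -` B \<inter> space M)))"
      by (subst emeasure_distr) (auto simp: emeasure_eq_measure)
    also have "prob ((U -` A \<inter> space M) \<inter> (V -` B \<inter> space M))
        = prob (U -` A \<inter> space M) * prob (V -` B \<inter> space M)"
      by (intro indep_setD[OF i]) auto
    finally show "emeasure (distr M S U) A * emeasure (distr M T V) B
        = emeasure (distr M (S \<Otimes>\<^sub>M T) (\<lambda>\<omega>. (U \<omega>, V \<omega>))) (A \<times> B)"
      by (simp add: emeasure_distr emeasure_eq_measure ennreal_mult)
  qed (auto intro: U.sigma_finite_measure_axioms V.sigma_finite_measure_axioms)
qed

text \<open>Conditioning on \<open>H = h\<close> leaves the law of the independent variable
  \<open>V\<close> unchanged, so \<open>h\<close> may simply be frozen in \<open>F\<close>.\<close>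

lemma cond_law_of_independent:
  assumes M: "prob_space M" and ind: "indep_rvs M S H R V"
    and F [measurable]: "(\<lambda>(h, u). F h u) \<in> measurable (S \<Otimes>\<^sub>M R) T"
  shows "cond_law M S T H (\<lambda>\<omega>. F (H \<omega>) (V \<omega>)) (\<lambda>h. distr (distr M R V) T (F h))"
  unfolding cond_law_def
proof (intro conjI ballI)
  interpret prob_space M by fact
  have [measurable]: "H \<in> measurable M S" "V \<in> measurable M R"
    using ind by (auto simp: indep_rvs_def)
  interpret V: prob_space "distr M R V" by (rule prob_space_distr) auto
  show "(\<lambda>h. distr (distr M R V) T (F h)) \<in> measurable S (prob_algebra T)"
    by (rule measurable_prob_algebraI)
      (auto intro!: V.prob_space_distr measurable_distr2[where M=R] 
        simp: space_subprob_algebra V.subprob_space_axioms)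
  fix A B assume [measurable]: "A \<in> sets S" "B \<in> sets T"
  have "emeasure M {\<omega> \<in> space M. H \<omega> \<in> A \<and> F (H \<omega>) (V \<omega>) \<in> B}
    = emeasure (distr M (S \<Otimes>\<^sub>M R) (\<lambda>\<omega>. (H \<omega>, V \<omega>)))
        {z \<in> space (S \<Otimes>\<^sub>M R). fst z \<in> A \<and> F (fst z) (snd z) \<in> B}"
    using measurable_space[of H M S] measurable_space[of V M R]
    by (subst emeasure_distr) (auto intro!: arg_cong2[where f=emeasure] simp: space_pair_measure)
  also have "\<dots> = (\<integral>\<^sup>+h. emeasure (distr M R V) (Pair h -` {z \<in> space (S \<Otimes>\<^sub>M R). fst z \<in> A \<and> F (fst z) (snd z) \<in> B})
      \<partial>distr M S H)"
    unfolding indep_rvs_distr_pair[OF M ind]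
    by (rule V.emeasure_pair_measure_alt) measurable
  also have "\<dots> = (\<integral>\<^sup>+h\<in>A. emeasure (distr (distr M R V) T (F h)) B \<partial>distr M S H)"
  proof (rule nn_integral_cong)
    fix h assume "h \<in> space (distr M S H)"
    then have h: "h \<in> space S" by simp
    then have [measurable]: "F h \<in> measurable R T" by measurable
    show "emeasure (distr M R V) (Pair h -` {z \<in> space (S \<Otimes>\<^sub>M R). fst z \<in> A \<and> F (fst z) (snd z) \<in> B})
      = emeasure (distr (distr M R V) T (F h)) B * indicator A h"
      using h by (subst (2) emeasure_distr)
        (auto intro!: arg_cong2[where f=emeasure] simp: space_pair_measure split: split_indicator)
  qed
  finally show "emeasure M {\<omega> \<in> space M. H \<omega> \<in> A \<and> F (H \<omega>) (V \<omega>) \<in> B}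
    = (\<integral>\<^sup>+h\<in>A. emeasure (distr (distr M R V) T (F h)) B \<partial>distr M S H)" .
qed

text \<open>For each single Borel set the two kernels agree off a null set that depends on the set.
  Second countability supplies a countable generator stable under intersection, so one null set
  suffices for all of them.\<close>

lemma cond_law_unique:
  fixes K K' :: "'h \<Rightarrow> 'z::second_countable_topology measure"
  assumes M: "prob_space M" and H [measurable]: "H \<in> measurable M S"
    and K: "cond_law M S borel H Z K" and K': "cond_law M S borel H Z K'"
  shows "AE \<omega> in M. K (H \<omega>) = K' (H \<omega>)"
proof -
  interpret prob_space M by fact
  interpret D: prob_space "distr M S H" by (rule prob_space_distr) auto
  obtain B :: "'z set set" where B: "countable B" "topological_basis B"
    using ex_countable_basis by blast
  \<comment> \<open>Finite intersections make the basis stable under intersection; the empty family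
    contributes \<open>UNIV\<close>, on which the measures are finite.\<close>
  define C where "C = Inter ` {F. finite F \<and> F \<subseteq> B}"
  have cC: "countable C"
    unfolding C_def by (intro countable_image countable_Collect_finite_subset B)
  have op: "\<And>c. c \<in> B \<Longrightarrow> open c"
    using B by (auto intro: topological_basis_open)
  then have opC: "\<And>c. c \<in> C \<Longrightarrow> open c"
    by (auto simp: C_def)
  have "UNIV \<in> C" unfolding C_def by (intro image_eqI[of _ _ "{}"]) auto
  have BC: "B \<subseteq> C"
  proof
    fix c assume "c \<in> B" then show "c \<in> C"
      unfolding C_def by (intro image_eqI[of _ _ "{c}"]) auto
  qed
  have stab: "Int_stable C"
  proof (rule Int_stableI)
    fix a b assume "a \<in> C" "b \<in> C"
    then obtain F G where "finite F" "F \<subseteq> B" "a = \<Inter> F" "finite G" "G \<subseteq> B" "b = \<Inter> G"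
      by (auto simp: C_def)
    then show "a \<inter> b \<in> C"
      unfolding C_def by (intro image_eqI[of _ _ "F \<union> G"]) auto
  qed
  have "sigma_sets UNIV C = sets borel"
  proof
    show "sigma_sets UNIV C \<subseteq> sets (borel :: 'z measure)"
    proof -
      have "C \<subseteq> sets borel" using opC by (auto intro: borel_open)
      then show ?thesis using sets.sigma_sets_subset[of C borel] by auto
    qed
    have "sets (borel :: 'z measure) = sigma_sets UNIV B"
      by (subst borel_eq_countable_basis[OF B]) (simp add: sets_measure_of)
    also have "\<dots> \<subseteq> sigma_sets UNIV C"
      using BC by (intro sigma_sets_mono) (auto intro: sigma_sets.Basic)
    finally show "sets (borel :: 'z measure) \<subseteq> sigma_sets UNIV C" .
  qed
  note gen = this[symmetric]
  have Km: "K \<in> measurable S (prob_algebra borel)" "K' \<in> measurable S (prob_algebra borel)"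
    using K K' by (auto simp: cond_law_def)
  have Ks [measurable]: "K \<in> measurable S (subprob_algebra borel)" "K' \<in> measurable S (subprob_algebra borel)"
    using Km by (auto intro: measurable_prob_algebraD)
  have "AE h in distr M S H. emeasure (K h) c = emeasure (K' h) c" if "c \<in> C" for c
  proof -
    have [measurable]: "c \<in> sets borel" using opC that by auto
    show ?thesis
    proof (rule D.density_unique2)
      fix A assume "A \<in> sets (distr M S H)"
      then have "A \<in> sets S" by simp
      then show "(\<integral>\<^sup>+h\<in>A. emeasure (K h) c \<partial>distr M S H) = (\<integral>\<^sup>+h\<in>A. emeasure (K' h) c \<partial>distr M S H)"
        using K K' by (simp add: cond_law_def)
    qed auto
  qed
  then have "AE h in distr M S H. \<forall>c\<in>C. emeasure (K h) c = emeasure (K' h) c"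
    using cC by (subst AE_ball_countable) auto
  then have "AE h in distr M S H. K h = K' h"
  proof (rule AE_mp, intro AE_I2 impI)
    fix h assume "h \<in> space (distr M S H)" and eq: "\<forall>c\<in>C. emeasure (K h) c = emeasure (K' h) c"
    then have h: "h \<in> space S" by simp
    have "K h \<in> space (prob_algebra borel)" "K' h \<in> space (prob_algebra borel)"
      using Km h by (auto dest: measurable_space)
    then have s: "sets (K h) = sets borel" "sets (K' h) = sets borel" "prob_space (K h)"
      by (auto simp: space_prob_algebra)
    interpret Kh: prob_space "K h" by fact
    show "K h = K' h"
      using stab eq \<open>UNIV \<in> C\<close> s gen
      by (intro measure_eqI_generator_eq[where E=C and \<Omega>=UNIV and A="\<lambda>_. UNIV"]) auto
  qed
  then show ?thesis by (rule AE_distrD[OF H])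
qed

section \<open>The law of the received signal\<close>

lemma if_zero_mult: "(if P then x else 0) * y = (if P then x * y else (0 :: 'a :: mult_zero))"
  by simp

lemma diag_mat_mult: "diag_mat a ** diag_mat b = diag_mat (\<lambda>j. a j * b j)"
  by (simp add: vec_eq_iff diag_mat_def matrix_matrix_mult_def if_zero_mult)

lemma diag_mat_one: "diag_mat (\<lambda>_. 1) = mat 1"
  by (simp add: vec_eq_iff diag_mat_def mat_def)

lemma ctranspose_diag_mat: "ctranspose (diag_mat d) = diag_mat (\<lambda>j. cnj (d j))"
  by (auto simp: vec_eq_iff diag_mat_def ctranspose_def)

lemma diag_mat_vec: "(diag_mat d *v x) $ j = d j * x $ j"
  by (simp add: diag_mat_def matrix_vector_mult_def if_zero_mult)

text \<open>Each row is read as a column vector and has its own matrix. This is a block diagonal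
  operator on the matrix space, kept as a family of small matrices so that products and adjoints are
  taken blockwise.\<close>

definition rowmap :: "('i \<Rightarrow> complex^'n^'m) \<Rightarrow> complex^'n^'i \<Rightarrow> complex^'m^'i" where
  "rowmap A z = (\<chi> i. A i *v z $ i)"

lemma linear_rowmap: "linear (rowmap A)"
proof -
  have "linear ((*v) (A i))" for i by (rule matrix_vector_mul_linear)
  then show ?thesis
    by (intro linearI) (auto simp: rowmap_def vec_eq_iff linear_add linear_cmul)
qed

lemma rowmap_rowmap: "rowmap A (rowmap B z) = rowmap (\<lambda>i. A i ** B i) z"
  by (simp add: rowmap_def matrix_vector_mul_assoc)

lemma inner_rowmap: "rowmap A x \<bullet> y = x \<bullet> rowmap (\<lambda>i. ctranspose (A i)) y"
proof -
  have "rowmap A x \<bullet> y = (\<Sum>i\<in>UNIV. (A i *v x $ i) \<bullet> y $ i)"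
    by (subst inner_vec_def) (simp add: rowmap_def)
  also have "\<dots> = x \<bullet> rowmap (\<lambda>i. ctranspose (A i)) y"
    by (subst inner_vec_def) (simp add: rowmap_def inner_mult_left)
  finally show ?thesis .
qed

lemma rowmap_mat_1: "rowmap (\<lambda>_. mat 1) x = x"
  by (simp add: rowmap_def)

lemma norm_rowmap_unitary:
  assumes "\<And>i. ctranspose (U i) ** U i = mat 1"
  shows "norm (rowmap U x) = norm x"
  by (simp add: norm_eq_sqrt_inner inner_rowmap rowmap_rowmap assms rowmap_mat_1)

lemma rowmap_add: "rowmap A x + rowmap B x = rowmap (\<lambda>i. A i + B i) x"
  by (simp add: rowmap_def vec_eq_iff matrix_vector_mult_add_rdistrib)

lemma rowmap_scaleR: "a *\<^sub>R rowmap A x = rowmap (\<lambda>i. a *\<^sub>R A i) x"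
  by (simp add: rowmap_def vec_eq_iff matrix_vector_mult_def scaleR_sum_right)

text \<open>A basis vector has one nonzero entry, of modulus 1, so the double sum selects the scale
  belonging to that entry. A real scale acts alike on real and imaginary parts, hence is diagonal in
  real coordinates.\<close>

lemma rowmap_diag_mat_eq_sum_Basis:
  fixes x :: "complex^'n^'i"
  shows "rowmap (\<lambda>i. diag_mat (\<lambda>j. of_real (s i j))) x
    = (\<Sum>b\<in>Basis. ((\<Sum>i\<in>UNIV. \<Sum>j\<in>UNIV. s i j * cmod (b $ i $ j)) * (x \<bullet> b)) *\<^sub>R b)"
proof (rule euclidean_eqI)
  fix b :: "complex^'n^'i" assume b: "b \<in> Basis"
  then obtain i j u where b': "b = axis i (axis j u)" and u: "u \<in> Basis"
    by (auto simp: Basis_vec_def)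
  have u1: "cmod u = 1" using u by (auto simp: Basis_complex_def)
  have "(\<Sum>i'\<in>UNIV. \<Sum>j'\<in>UNIV. s i' j' * cmod (b $ i' $ j')) = s i j"
  proof -
    have "s i' j' * cmod (b $ i' $ j') = (if i' = i then if j' = j then s i j else 0 else 0)" for i' j'
      by (auto simp: b' axis_def u1)
    then show ?thesis by (simp add: sum.If_cases)
  qed
  moreover have "rowmap (\<lambda>i. diag_mat (\<lambda>j. of_real (s i j))) x \<bullet> b = s i j * (x \<bullet> b)"
    by (simp add: b' inner_axis rowmap_def diag_mat_vec inner_complex_def algebra_simps)
  ultimately show "rowmap (\<lambda>i. diag_mat (\<lambda>j. of_real (s i j))) x \<bullet> b
    = (\<Sum>b\<in>Basis. ((\<Sum>i\<in>UNIV. \<Sum>j\<in>UNIV. s i j * cmod (b $ i $ j)) * (x \<bullet> b)) *\<^sub>R b) \<bullet> b"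
    using b by (simp add: inner_sum_left_Basis)
qed

text \<open>Every complex entry carries two basis vectors, \<open>1\<close> and \<open>\<i>\<close>,
  with the same scale: this is the origin of the squares.\<close>

lemma prod_Basis_complex_vec_vec:
  fixes s :: "'i::finite \<Rightarrow> 'n::finite \<Rightarrow> real"
  shows "(\<Prod>b\<in>(Basis :: (complex^'n^'i) set). \<Sum>i\<in>UNIV. \<Sum>j\<in>UNIV. s i j * cmod (b $ i $ j))
    = (\<Prod>i\<in>UNIV. \<Prod>j\<in>UNIV. (s i j)\<^sup>2)"
proof -
  have "(\<Sum>i'\<in>UNIV. \<Sum>j'\<in>UNIV. s i' j' * cmod (axis i (axis j u) $ i' $ j')) = s i j"
    if "u \<in> Basis" for i j and u :: complex
  proof -
    have "cmod u = 1" using that by (auto simp: Basis_complex_def)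
    then have "s i' j' * cmod (axis i (axis j u) $ i' $ j') = (if i' = i then if j' = j then s i j else 0 else 0)" for i' j'
      by (auto simp: axis_def)
    then show ?thesis by (simp add: sum.If_cases)
  qed
  then show ?thesis
    by (simp add: prod_Basis_vec cong: prod.cong_simp)
qed

text \<open>The law of \<open>B z + \<surd>v w\<close> only depends on \<open>B B\<^sup>H + v I = D D\<^sup>H\<close>, since
  \<open>(z, w) \<mapsto> D\<^sup>-\<^sup>1 (B z + \<surd>v w)\<close> is a coisometry.\<close>

lemma distr_gauss_rowmap_plus_noise:
  fixes B :: "'i::finite \<Rightarrow> complex^'t^'r" and U :: "'i \<Rightarrow> complex^'r^'r" and l :: "'i \<Rightarrow> 'r \<Rightarrow> real"
  assumes v: "v > 0" and l: "\<And>i j. l i j > 0"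
    and U: "\<And>i. ctranspose (U i) ** U i = mat 1" "\<And>i. U i ** ctranspose (U i) = mat 1"
    and S: "\<And>i. B i ** ctranspose (B i) + v *\<^sub>R mat 1
      = U i ** diag_mat (\<lambda>j. of_real (l i j)) ** ctranspose (U i)"
  obtains E :: "complex^'r^'i \<Rightarrow> complex^'r^'i" where "linear E"
    "distr (gauss 1) borel (\<lambda>(z, w). rowmap B z + sqrt v *\<^sub>R w)
      = density lborel (\<lambda>y. ennreal (exp (- (norm (E y))\<^sup>2) /
          (sqrt pi ^ DIM(complex^'r^'i) * (\<Prod>i\<in>UNIV. \<Prod>j\<in>UNIV. l i j))))"
    "distr (distr (gauss 1) borel (\<lambda>(z, w). rowmap B z + sqrt v *\<^sub>R w)) borel E = gauss 1"
proof -
  define s where "s i j = sqrt (l i j)" for i j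
  have s: "s i j > 0" "s i j \<noteq> 0" "s i j * s i j = l i j" for i j
    using l[of i j] by (auto simp: s_def)
  define \<Delta> where "\<Delta> i = (diag_mat (\<lambda>j. of_real (s i j)) :: complex^'r^'r)" for i
  define \<Delta>' where "\<Delta>' i = (diag_mat (\<lambda>j. of_real (1 / s i j)) :: complex^'r^'r)" for i
  have \<Delta>: "\<Delta> i ** \<Delta>' i = mat 1" "\<Delta>' i ** \<Delta> i = mat 1" "ctranspose (\<Delta>' i) = \<Delta>' i"
     "diag_mat (\<lambda>j. of_real (l i j)) = \<Delta> i ** \<Delta> i" for i
    by (simp_all add: \<Delta>_def \<Delta>'_def diag_mat_mult diag_mat_one ctranspose_diag_mat s
      flip: of_real_mult)
  define D where "D = rowmap (\<lambda>i. U i ** \<Delta> i)"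
  \<comment> \<open>\<open>E\<close> inverts \<open>D\<close>, and \<open>E'\<close> is the adjoint
    of \<open>E\<close>; likewise \<open>L'\<close> is the adjoint of \<open>L\<close>, so that
    \<open>Q'\<close> is the adjoint of \<open>Q\<close>.\<close>
  define E where "E = rowmap (\<lambda>i. \<Delta>' i ** ctranspose (U i))"
  define E' where "E' = rowmap (\<lambda>i. U i ** \<Delta>' i)"
  define L where "L x = (case x of (z, w) \<Rightarrow> rowmap B z + sqrt v *\<^sub>R w)" for x
  define L' where "L' y = (rowmap (\<lambda>i. ctranspose (B i)) y, sqrt v *\<^sub>R y)" for y
  define Q where "Q x = E (L x)" for x
  define Q' where "Q' y = L' (E' y)" for y
  have lE: "linear E" and lE': "linear E'" and lD: "linear D"
    by (auto simp: E_def E'_def D_def linear_rowmap)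
  have lL: "linear L"
    unfolding L_def case_prod_beta
    by (intro linear_compose_add linear_compose_scale_right linear_compose[OF _ linear_rowmap, unfolded o_def])
      (auto intro: bounded_linear.linear bounded_linear_fst bounded_linear_snd)
  have lL': "linear L'"
    using linear_rowmap[of "\<lambda>i. ctranspose (B i)"]
    by (auto simp: L'_def linear_add linear_cmul scaleR_add_right intro!: linearI)
  have [measurable]: "E \<in> borel_measurable borel" "D \<in> borel_measurable borel" "L \<in> borel_measurable borel"
    by (rule borel_measurable_linear, rule lE lD lL)+
  have lQ: "linear Q" "linear Q'"
    using linear_compose[OF lL lE] linear_compose[OF lE' lL'] by (auto simp: Q_def[abs_def] Q'_def[abs_def] o_def)
  have [measurable]: "Q \<in> borel_measurable borel" by (rule borel_measurable_linear[OF lQ(1)])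
  have ED: "E (D x) = x" for x
    by (simp add: E_def D_def rowmap_rowmap matrix_mul_assoc[symmetric])
       (simp add: matrix_mul_assoc \<Delta> U rowmap_mat_1)
  have DE: "D (E x) = x" for x
    by (simp add: E_def D_def rowmap_rowmap matrix_mul_assoc)
       (simp add: matrix_mul_assoc[symmetric] \<Delta> U rowmap_mat_1)
  have adj: "Q x \<bullet> y = x \<bullet> Q' y" for x y
  proof -
    have "E a \<bullet> y = a \<bullet> E' y" for a
      by (simp add: E_def E'_def inner_rowmap ctranspose_mult \<Delta>)
    moreover have "L x \<bullet> a = x \<bullet> L' a" for a
      by (cases x) (simp add: L_def L'_def inner_add_left inner_rowmap)
    ultimately show ?thesis by (simp add: Q_def Q'_def)
  qed
  \<comment> \<open>On each row \<open>L (L' a)\<close> multiplies by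
    \<open>B B^H + v I = (U \<Delta>) (U \<Delta>)^H\<close>, and \<open>E\<close> and
    \<open>E'\<close> cancel these two factors.\<close>
  have one: "Q (Q' y) = y" for y
  proof -
    have "L (L' a) = rowmap (\<lambda>i. B i ** ctranspose (B i) + v *\<^sub>R mat 1) a" for a
    proof -
      have "v *\<^sub>R a = rowmap (\<lambda>i. v *\<^sub>R mat 1) a"
        by (simp add: rowmap_scaleR[symmetric] rowmap_mat_1)
      then show ?thesis
        using v by (simp add: L_def L'_def rowmap_rowmap rowmap_add)
    qed
    also have "\<dots> a = rowmap (\<lambda>i. U i ** \<Delta> i ** \<Delta> i ** ctranspose (U i)) a" for a
      by (simp add: S \<Delta> matrix_mul_assoc)
    finally have "Q (Q' y) = rowmap (\<lambda>i. \<Delta>' i ** ctranspose (U i) ** (U i ** \<Delta> i ** \<Delta> i ** ctranspose (U i) ** (U i ** \<Delta>' i))) y"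
      by (simp add: Q_def Q'_def E_def E'_def rowmap_rowmap)
    also have "(\<lambda>i. \<Delta>' i ** ctranspose (U i) ** (U i ** \<Delta> i ** \<Delta> i ** ctranspose (U i) ** (U i ** \<Delta>' i)))
       = (\<lambda>i. \<Delta>' i ** (ctranspose (U i) ** U i) ** \<Delta> i ** \<Delta> i ** (ctranspose (U i) ** U i) ** \<Delta>' i)"
      by (simp add: matrix_mul_assoc)
    also have "\<dots> = (\<lambda>i. (\<Delta>' i ** \<Delta> i) ** (\<Delta> i ** \<Delta>' i))"
      by (simp add: U matrix_mul_assoc)
    finally show ?thesis by (simp add: \<Delta> rowmap_mat_1)
  qed
  \<comment> \<open>\<open>L = D Q\<close>, and the coisometry \<open>Q\<close> produces a standard
    Gaussian of the output dimension: the input \<open>(z, w)\<close> is thereby reduced to one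
    vector \<open>u\<close>.\<close>
  have "distr (gauss 1) borel L = distr (distr (gauss 1) borel Q) borel D"
    by (subst distr_distr) (auto simp: o_def Q_def DE)
  also have "distr (gauss 1) borel Q = gauss 1"
    by (rule gauss_distr_coisometry[OF _ lQ adj one]) simp
  finally have law: "distr (gauss 1) borel L = distr (gauss 1) borel D" .
  define c where "c b = (\<Sum>i\<in>UNIV. \<Sum>j\<in>UNIV. s i j * cmod (b $ i $ j))" for b :: "complex^'r^'i"
  have "distr (gauss 1) borel D = density lborel (\<lambda>y. ennreal (exp (- (norm (E y))\<^sup>2) /
          (sqrt pi ^ DIM(complex^'r^'i) * prod c Basis)))"
  proof (rule gauss_distr_diag_isometry)
    show "linear (rowmap U)" "norm (rowmap U x) = norm x" for x
      by (simp_all add: linear_rowmap norm_rowmap_unitary U)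
    show "D x = rowmap U (\<Sum>b\<in>Basis. (c b * (x \<bullet> b)) *\<^sub>R b)" for x
      by (simp add: c_def rowmap_diag_mat_eq_sum_Basis[symmetric] D_def \<Delta>_def rowmap_rowmap)
    show "c b > 0" if b: "b \<in> Basis" for b
    proof -
      obtain i j where "b $ i $ j \<noteq> 0"
        using nonzero_Basis[OF b] by (auto simp: vec_eq_iff)
      then have "0 < s i j * cmod (b $ i $ j)" using s by simp
      also have "\<dots> \<le> (\<Sum>j\<in>UNIV. s i j * cmod (b $ i $ j))"
        by (intro member_le_sum) (auto simp: s(1)[THEN less_imp_le])
      also have "\<dots> \<le> c b"
        unfolding c_def
        by (intro member_le_sum[where f="\<lambda>i. \<Sum>j\<in>UNIV. s i j * cmod (b $ i $ j)"])
          (auto simp: s(1)[THEN less_imp_le] intro!: sum_nonneg)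
      finally show ?thesis .
    qed
  qed (rule lE ED)+
  also have "prod c Basis = (\<Prod>i\<in>UNIV. \<Prod>j\<in>UNIV. l i j)"
    unfolding c_def prod_Basis_complex_vec_vec by (simp add: power2_eq_square s)
  finally have dens: "distr (gauss 1) borel L = density lborel (\<lambda>y. ennreal (exp (- (norm (E y))\<^sup>2) /
          (sqrt pi ^ DIM(complex^'r^'i) * (\<Prod>i\<in>UNIV. \<Prod>j\<in>UNIV. l i j))))"
    by (simp only: law)
  have "distr (distr (gauss 1) borel L) borel E = gauss 1"
    unfolding law by (subst distr_distr) (auto simp: o_def ED distr_id2)
  with lE dens show ?thesis
    by (intro that[of E]) (simp_all add: L_def[abs_def])
qed

text \<open>\<open>E\<close> whitens the law, so the mean of the quadratic exponent is that of a
  standard Gaussian whatever \<open>E\<close> is. Only \<open>Z\<close> distinguishes two such laws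
  on the same space.\<close>

lemma integral_log_gauss_density:
  fixes E :: "'a::euclidean_space \<Rightarrow> 'a"
  assumes E: "linear E" and Z: "Z > 0"
    and f: "\<And>y. f y = exp (- (norm (E y))\<^sup>2) / Z"
    and law: "distr (density lborel f) borel E = gauss 1"
  shows "integrable (density lborel f) (\<lambda>y. log 2 (f y))" (is ?int)
    and "(\<integral>y. log 2 (f y) \<partial>density lborel f) = - (\<integral>x. (norm x)\<^sup>2 \<partial>(gauss 1 :: 'a measure)) / ln 2 - log 2 Z" (is ?eq)
proof -
  let ?F = "density lborel f"
  have [measurable]: "E \<in> borel_measurable borel" by (rule borel_measurable_linear[OF E])
  have [measurable]: "f \<in> borel_measurable borel" unfolding f[abs_def] by measurable
  have log_f: "log 2 (f y) = - (norm (E y))\<^sup>2 / ln 2 - log 2 Z" for y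
  proof -
    have "log 2 (f y) = log 2 (exp (- (norm (E y))\<^sup>2)) - log 2 Z"
      unfolding f using Z by (intro log_divide_pos) auto
    then show ?thesis by (simp add: log_def)
  qed
  \<comment> \<open>That \<open>f\<close> integrates to 1 is inferred from its image under
    \<open>E\<close> having total mass 1.\<close>
  have "prob_space (distr ?F borel E)"
    unfolding law by (rule prob_space_gauss) simp
  then have "prob_space ?F"
    using prob_space_distrD[of E ?F borel] by simp
  then interpret F: prob_space ?F .
  have "integrable (distr ?F borel E) (\<lambda>x. (norm x)\<^sup>2)"
    unfolding law by (rule integrable_gauss_norm_square) simp
  then have int: "integrable ?F (\<lambda>y. (norm (E y))\<^sup>2)"
    by (subst (asm) integrable_distr_eq) auto
  have "(\<integral>x. (norm x)\<^sup>2 \<partial>distr ?F borel E) = (\<integral>y. (norm (E y))\<^sup>2 \<partial>?F)"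
    by (rule integral_distr) auto
  then have eq: "(\<integral>y. (norm (E y))\<^sup>2 \<partial>?F) = (\<integral>x. (norm x)\<^sup>2 \<partial>(gauss 1 :: 'a measure))"
    by (simp add: law)
  show ?int unfolding log_f using int by auto
  show ?eq
    unfolding log_f using int
    by (subst Bochner_Integration.integral_diff) (auto simp: eq F.prob_space[simplified])
qed

section \<open>Measurability of matrix operations and algebra of block diagonal matrices\<close>

lemma borel_measurable_vec_nth [measurable (raw)]:
  fixes f :: "'b \<Rightarrow> 'a::euclidean_space^'n"
  assumes "f \<in> borel_measurable M"
  shows "(\<lambda>x. f x $ i) \<in> borel_measurable M"
  by (rule measurable_compose[OF assms])
    (intro borel_measurable_linear bounded_linear.linear bounded_linear_vec_nth)

lemma borel_measurable_matrix_mult [measurable (raw)]: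
  fixes f :: "'b \<Rightarrow> complex^'n^'m" and g :: "'b \<Rightarrow> complex^'k^'n"
  assumes [measurable]: "f \<in> borel_measurable M" "g \<in> borel_measurable M"
  shows "(\<lambda>x. f x ** g x) \<in> borel_measurable M"
  unfolding matrix_matrix_mult_def by (intro borel_measurable_vec_lambda) measurable

lemma borel_measurable_ctranspose [measurable (raw)]:
  fixes f :: "'b \<Rightarrow> complex^'n^'m"
  assumes [measurable]: "f \<in> borel_measurable M"
  shows "(\<lambda>x. ctranspose (f x)) \<in> borel_measurable M"
  unfolding ctranspose_def
  by (intro borel_measurable_vec_lambda borel_measurable_continuous_on[OF continuous_on_cnj]) 
    (auto intro: continuous_intros)

lemma block_diag_mult:
  fixes A :: "'c::finite \<Rightarrow> complex^'n^'m" and B :: "'c \<Rightarrow> complex^'k^'n"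
  shows "block_diag A ** block_diag B = block_diag (\<lambda>p. A p ** B p)"
proof -
  have "(\<Sum>w\<in>UNIV. (if p = fst w then A p $ i $ snd w else 0) *
          (if fst w = q then B (fst w) $ snd w $ j else 0))
      = (if p = q then \<Sum>s\<in>UNIV. A p $ i $ s * B p $ s $ j else 0)" for p q i j
  proof -
    have "(\<Sum>w\<in>UNIV. (if p = fst w then A p $ i $ snd w else 0) *
          (if fst w = q then B (fst w) $ snd w $ j else 0))
        = (\<Sum>p'\<in>UNIV. \<Sum>s\<in>UNIV. (if p = p' then A p $ i $ s else 0) *
          (if p' = q then B p' $ s $ j else 0))"
      unfolding UNIV_Times_UNIV[symmetric] sum.cartesian_product by (simp add: case_prod_beta)
    also have "\<dots> = (\<Sum>p'\<in>UNIV. if p' = p then (if p = q then \<Sum>s\<in>UNIV. A p $ i $ s * B p $ s $ j else 0) else 0)"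
      by (intro sum.cong) auto
    finally show ?thesis by simp
  qed
  then show ?thesis
    by (simp add: vec_eq_iff matrix_matrix_mult_def block_diag_def)
qed

lemma ctranspose_block_diag: "ctranspose (block_diag A) = block_diag (\<lambda>p. ctranspose (A p))"
  by (auto simp: vec_eq_iff ctranspose_def block_diag_def)

lemma transpose_block_diag: "transpose (block_diag A) = block_diag (\<lambda>p. transpose (A p))"
  by (auto simp: vec_eq_iff transpose_def block_diag_def)

lemma block_diag_add: "block_diag A + block_diag B = block_diag (\<lambda>p. A p + B p)"
  by (auto simp: vec_eq_iff block_diag_def)

lemma scaleR_block_diag: "a *\<^sub>R block_diag A = block_diag (\<lambda>p. a *\<^sub>R A p)"
  by (auto simp: vec_eq_iff block_diag_def)

lemma block_diag_diag_mat: "block_diag (\<lambda>p. diag_mat (d p)) = diag_mat (\<lambda>(p, j). d p j)"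
  by (auto simp: vec_eq_iff block_diag_def diag_mat_def prod_eq_iff)

lemma block_diag_mat_1: "block_diag (\<lambda>_. mat 1) = mat 1"
  by (simp add: diag_mat_one[symmetric] block_diag_diag_mat case_prod_unfold)

text \<open>The blockwise unitary factors form mutually inverse large matrices, so by
  multiplicativity their determinants cancel and a diagonal determinant remains.\<close>

lemma det_block_diag_diagonalized:
  fixes U :: "'c::finite \<Rightarrow> complex^'n^'n"
  assumes U: "\<And>p. U p ** ctranspose (U p) = mat 1"
  shows "det (block_diag (\<lambda>p. U p ** diag_mat (d p) ** ctranspose (U p))) = (\<Prod>p\<in>UNIV. \<Prod>j\<in>UNIV. d p j)"
proof -
  have "det (block_diag U) * det (block_diag (\<lambda>p. ctranspose (U p))) = 1"
    by (simp add: det_mul[symmetric] block_diag_mult U block_diag_mat_1)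
  moreover have "det (block_diag (\<lambda>p. U p ** diag_mat (d p) ** ctranspose (U p)))
    = det (block_diag U) * det (block_diag (\<lambda>p. diag_mat (d p))) * det (block_diag (\<lambda>p. ctranspose (U p)))"
    by (simp add: det_mul[symmetric] block_diag_mult)
  moreover have "det (block_diag (\<lambda>p. diag_mat (d p))) = (\<Prod>(p, j)\<in>UNIV. d p j)"
    unfolding block_diag_diag_mat by (subst det_diagonal) (auto simp: diag_mat_def case_prod_beta)
  moreover have "(\<Prod>(p, j)\<in>UNIV. d p j) = (\<Prod>p\<in>UNIV. \<Prod>j\<in>UNIV. d p j)"
    by (simp add: prod.cartesian_product)
  ultimately show ?thesis by (simp add: mult_ac)
qed

lemma gram_plus_scalar_diagonalization:
  fixes B :: "complex^'t^'r"
  assumes v: "v > 0"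
  obtains U and l :: "'r \<Rightarrow> real"
  where "ctranspose U ** U = mat 1" "U ** ctranspose U = mat 1"
    "B ** ctranspose B + v *\<^sub>R mat 1 = U ** diag_mat (\<lambda>j. of_real (l j)) ** ctranspose U"
    "\<And>j. l j > 0"
proof -
  let ?S = "B ** ctranspose B + v *\<^sub>R mat 1"
  have add: "ctranspose (X + Y) = ctranspose X + ctranspose Y" for X Y :: "complex^'r^'r"
    by (simp add: ctranspose_def vec_eq_iff)
  have sc: "ctranspose (v *\<^sub>R mat 1) = (v *\<^sub>R mat 1 :: complex^'r^'r)"
    by (simp add: ctranspose_def vec_eq_iff mat_def)
  have "ctranspose ?S = ?S"
    by (simp add: add sc ctranspose_mult)
  from hermitian_diagonalization[OF this] obtain U and l :: "'r \<Rightarrow> real"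
    where U: "ctranspose U ** U = mat 1" "U ** ctranspose U = mat 1"
    and S: "?S = U ** diag_mat (\<lambda>j. of_real (l j)) ** ctranspose U" by blast
  \<comment> \<open>For the unit eigenvector \<open>x\<close>, column \<open>j\<close> of
    \<open>U\<close>, the quadratic form yields
    \<open>l j = (norm (ctranspose B *v x))^2 + v\<close>.\<close>
  have "l j > 0" for j
  proof -
    define e :: "complex^'r" where "e = axis j 1"
    define x where "x = U *v e"
    have "x \<bullet> x = e \<bullet> (ctranspose U *v x)"
      unfolding x_def by (rule inner_mult_left)
    also have "\<dots> = 1"
      by (simp add: x_def matrix_vector_mul_assoc U e_def inner_axis)
    finally have xx: "x \<bullet> x = 1" .
    have "x \<bullet> (?S *v x) = e \<bullet> (ctranspose U *v (?S *v x))"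
      unfolding x_def by (rule inner_mult_left)
    also have "ctranspose U *v (?S *v x) = (ctranspose U ** U) ** diag_mat (\<lambda>j. of_real (l j)) ** (ctranspose U ** U) *v e"
      unfolding S x_def by (simp add: matrix_vector_mul_assoc matrix_mul_assoc)
    also have "\<dots> = diag_mat (\<lambda>j. of_real (l j)) *v e"
      by (simp add: U)
    also have "e \<bullet> \<dots> = l j"
      by (simp add: e_def inner_commute[of "axis j 1"] inner_axis diag_mat_vec)
    finally have "l j = x \<bullet> (?S *v x)" by simp
    also have "?S *v x = B *v (ctranspose B *v x) + v *\<^sub>R x"
    proof -
      have "(v *\<^sub>R mat 1) *v x = v *\<^sub>R (mat 1 *v x)"
        by (simp add: vec_eq_iff matrix_vector_mult_def scaleR_sum_right)
      then show ?thesis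
        by (simp add: matrix_vector_mult_add_rdistrib matrix_vector_mul_assoc)
    qed
    also have "x \<bullet> \<dots> = (ctranspose B *v x) \<bullet> (ctranspose B *v x) + v * (x \<bullet> x)"
      using inner_mult_left[of B "ctranspose B *v x" x] by (simp add: inner_add_right inner_commute)
    also have "\<dots> > 0" using xx v by (simp add: add_nonneg_pos)
    finally show ?thesis .
  qed
  with U S show ?thesis by (rule that)
qed

section \<open>Second moments of the transmit signal and its passage through the channel\<close>

lemma has_bochner_integral_vec:
  fixes f :: "'w \<Rightarrow> 'a::euclidean_space^'n"
  assumes "\<And>i. has_bochner_integral M (\<lambda>x. f x $ i) (c $ i)"
  shows "has_bochner_integral M f c"
proof -
  have vec: "y = (\<Sum>i\<in>UNIV. axis i (y $ i))" for y :: "'a^'n"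
    by (simp add: vec_eq_iff axis_def)
  have "bounded_linear (axis i :: 'a \<Rightarrow> 'a^'n)" for i
    unfolding linear_conv_bounded_linear[symmetric]
    by (rule linearI) (auto simp: axis_def vec_eq_iff)
  then have "has_bochner_integral M (\<lambda>x. axis i (f x $ i)) (axis i (c $ i) :: 'a^'n)" for i
    by (rule has_bochner_integral_bounded_linear[OF _ assms])
  then have "has_bochner_integral M (\<lambda>x. \<Sum>i\<in>UNIV. axis i (f x $ i)) (\<Sum>i\<in>UNIV. axis i (c $ i))"
    by (rule has_bochner_integral_sum)
  then show ?thesis by (simp only: vec[symmetric])
qed

text \<open>Real and imaginary parts are uncorrelated with second moment 1/2 each: for
  \<open>k = l\<close> the real part gives 1/2 + 1/2, and every mixed term has mean 0.\<close>

lemma gauss_entry_covariance: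
  "has_bochner_integral (gauss 1 :: (complex^'n^'i) measure)
     (\<lambda>z. cnj (z $ i $ k) * z $ i $ l) (if k = l then 1 else 0)"
proof -
  define m where "m b b' = (if b = b' then 1 / 2 else (0::real))" for b b' :: "complex^'n^'i"
  let ?e = "\<lambda>k u. axis i (axis k u) :: complex^'n^'i"
  have B: "?e k u \<in> Basis" if "u = 1 \<or> u = \<i>" for k u
    using that by (auto simp: Basis_vec_def Basis_complex_def)
  have mom: "has_bochner_integral (gauss 1) (\<lambda>z. complex_of_real ((z \<bullet> ?e k u) * (z \<bullet> ?e l u'))) (of_real (m (?e k u) (?e l u')))"
    if "u = 1 \<or> u = \<i>" "u' = 1 \<or> u' = \<i>" for u u'
    using gauss_second_moment[of 1, OF _ B[OF that(1)] B[OF that(2)], of k l]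
    by (intro has_bochner_integral_of_real) (simp add: m_def)
  have "has_bochner_integral (gauss 1 :: (complex^'n^'i) measure)
     (\<lambda>z. (complex_of_real ((z \<bullet> ?e k 1) * (z \<bullet> ?e l 1)) + complex_of_real ((z \<bullet> ?e k \<i>) * (z \<bullet> ?e l \<i>)))
        + \<i> * (complex_of_real ((z \<bullet> ?e k 1) * (z \<bullet> ?e l \<i>)) - complex_of_real ((z \<bullet> ?e k \<i>) * (z \<bullet> ?e l 1))))
     ((of_real (m (?e k 1) (?e l 1)) + of_real (m (?e k \<i>) (?e l \<i>)))
        + \<i> * (of_real (m (?e k 1) (?e l \<i>)) - of_real (m (?e k \<i>) (?e l 1))))"
    by (intro has_bochner_integral_add has_bochner_integral_diff has_bochner_integral_mult_right mom) auto
  moreover have "(complex_of_real ((z \<bullet> ?e k 1) * (z \<bullet> ?e l 1)) + complex_of_real ((z \<bullet> ?e k \<i>) * (z \<bullet> ?e l \<i>)))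
        + \<i> * (complex_of_real ((z \<bullet> ?e k 1) * (z \<bullet> ?e l \<i>)) - complex_of_real ((z \<bullet> ?e k \<i>) * (z \<bullet> ?e l 1)))
      = cnj (z $ i $ k) * z $ i $ l" for z
    by (simp add: inner_axis complex_eq_iff)
  moreover have "(of_real (m (?e k 1) (?e l 1)) + of_real (m (?e k \<i>) (?e l \<i>)))
        + \<i> * (of_real (m (?e k 1) (?e l \<i>)) - of_real (m (?e k \<i>) (?e l 1))) = (if k = l then 1 else (0::complex))"
    by (auto simp: m_def axis_eq_axis)
  ultimately show ?thesis by (simp only:)
qed

text \<open>The block diagonal transmit matrix as a linear image of a standard Gaussian
  \<open>z\<close>, whose rows are indexed by (subcarrier, OFDM symbol). The factor
  \<open>A p\<close> depends on the subcarrier only, since the rows of one subcarrier have equal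
  law.\<close>

definition signal :: "('c::finite \<Rightarrow> complex^'t^'t) \<Rightarrow> complex^'t^('c \<times> 'x::finite) \<Rightarrow> complex^('c \<times> 't)^('c \<times> 'x)" where
  "signal A z = block_diag (\<lambda>p. \<chi> i. A p *v z $ (p, i))"

text \<open>Entry (a, b) of the Gram matrix averages \<open>cnj x_a * x_b\<close>, the conjugate of
  the covariance entry; for a Hermitian matrix conjugation is transposition. The
  \<open>CARD('x)\<close> rows of a block contribute equally, and blocks off the diagonal vanish
  identically.\<close>

lemma has_bochner_integral_signal_gram:
  fixes A :: "'c::finite \<Rightarrow> complex^'t^'t"
  shows "has_bochner_integral (gauss 1 :: (complex^'t^('c \<times> 'x::finite)) measure)
    (\<lambda>z. ctranspose (signal A z) ** signal A z)
    (real CARD('x) *\<^sub>R block_diag (\<lambda>p. transpose (A p ** ctranspose (A p))))"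
proof (intro has_bochner_integral_vec)
  fix u v :: "'c \<times> 't"
  obtain p a q b where uv: "u = (p, a)" "v = (q, b)" by fastforce
  have prodsum: "(\<Sum>k\<in>K. cnj (f k) * cnj (g k)) * (\<Sum>l\<in>K. f' l * g l)
      = (\<Sum>k\<in>K. \<Sum>l\<in>K. (cnj (f k) * f' l) * (cnj (g k) * g l))" for f f' g and K :: "'t set"
    unfolding sum_product by (simp add: mult_ac)
  have entry: "(ctranspose (signal A z) ** signal A z) $ u $ v =
     (if p = q then \<Sum>i\<in>UNIV. \<Sum>k\<in>UNIV. \<Sum>l\<in>UNIV. (cnj (A p $ a $ k) * A p $ b $ l) * (cnj (z $ (p, i) $ k) * z $ (p, i) $ l) else 0)"
    for z :: "complex^'t^('c \<times> 'x)"
    unfolding signal_def ctranspose_block_diag block_diag_mult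
    by (simp add: block_diag_def uv matrix_matrix_mult_def ctranspose_def matrix_vector_mult_def prodsum)
  have delta: "(\<Sum>l\<in>UNIV. f l * (if k = l then 1 else 0)) = f k" for f :: "'t \<Rightarrow> complex" and k
    by (simp add: mult.commute[of _ "if _ then _ else _"] if_zero_mult)
  have val: "(real CARD('x) *\<^sub>R block_diag (\<lambda>p. transpose (A p ** ctranspose (A p)))) $ u $ v =
     (if p = q then \<Sum>i\<in>(UNIV::'x set). \<Sum>k\<in>UNIV. \<Sum>l\<in>UNIV. (cnj (A p $ a $ k) * A p $ b $ l) * (if k = l then 1 else 0) else 0)"
    by (simp add: block_diag_def uv matrix_matrix_mult_def ctranspose_def transpose_def delta
       scaleR_conv_of_real[where 'a=complex]) (simp add: mult.commute)
  show "has_bochner_integral (gauss 1 :: (complex^'t^('c \<times> 'x)) measure)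
    (\<lambda>z. (ctranspose (signal A z) ** signal A z) $ u $ v)
    ((real CARD('x) *\<^sub>R block_diag (\<lambda>p. transpose (A p ** ctranspose (A p)))) $ u $ v)"
  proof (cases "p = q")
    case True
    then show ?thesis
      unfolding entry val if_P[OF True]
      by (intro has_bochner_integral_sum has_bochner_integral_mult_right gauss_entry_covariance)
  next
    case False
    then show ?thesis unfolding entry val by (simp add: has_bochner_integral_zero)
  qed
qed

text \<open>A row times \<open>G p\<close>, read as a column, is \<open>transpose (G p)\<close>
  applied to that row.\<close>

lemma signal_mult_stack:
  "signal A z ** stack G = rowmap (\<lambda>(p, i). transpose (G p) ** A p) z"
proof -
  have "((\<chi> i. A p *v z $ (p, i)) ** G p) $ i = transpose (G p) *v (A p *v z $ (p, i))" for p i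
    by (simp add: vec_eq_iff matrix_matrix_mult_def matrix_vector_mult_def transpose_def mult.commute)
  then show ?thesis
    unfolding signal_def block_diag_mult_stack
    by (simp add: stack_def rowmap_def vec_eq_iff matrix_vector_mul_assoc case_prod_beta)
qed

lemma linear_signal: "linear (signal A :: complex^'t^('c::finite \<times> 'x::finite) \<Rightarrow> _)"
proof -
  have "linear ((*v) (A p))" for p by (rule matrix_vector_mul_linear)
  then show ?thesis
    by (intro linearI) (auto simp: signal_def block_diag_def vec_eq_iff linear_add linear_cmul)
qed

section \<open>Entropy of the noise and mutual information of a frozen channel\<close>

definition gauss_density :: "real \<Rightarrow> 'a::euclidean_space \<Rightarrow> real" where
  "gauss_density v x = exp (- (norm x)\<^sup>2 / v) / sqrt (pi * v) ^ DIM('a)"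

lemma borel_measurable_gauss_density [measurable]: "gauss_density v \<in> borel_measurable borel"
  unfolding gauss_density_def by measurable

lemma gauss_density_pos: "v > 0 \<Longrightarrow> gauss_density v x > 0"
  by (simp add: gauss_density_def)

lemma gauss_eq_density: "gauss v = density lborel (gauss_density v)"
  by (simp add: gauss_def gauss_density_def)

lemma integral_log_gauss:
  assumes v: "v > 0"
  shows "integrable (gauss v) (\<lambda>x::'a::euclidean_space. log 2 (gauss_density v x))" (is ?int)
    and "(\<integral>x. log 2 (gauss_density v x) \<partial>(gauss v :: 'a measure))
      = - (\<integral>x. (norm x)\<^sup>2 \<partial>(gauss 1 :: 'a measure)) / ln 2 - log 2 (sqrt (pi * v) ^ DIM('a))" (is ?eq)
proof -
  let ?E = "\<lambda>x::'a. (1 / sqrt v) *\<^sub>R x"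
  have E: "linear ?E" by (rule linear_scale_self)
  have f: "gauss_density v y = exp (- (norm (?E y))\<^sup>2) / sqrt (pi * v) ^ DIM('a)" for y :: 'a
    using v by (simp add: gauss_density_def power_divide)
  have "distr (density lborel (gauss_density v)) borel ?E = distr (gauss 1) borel (\<lambda>x. x)"
    unfolding gauss_eq_density[symmetric] gauss_eq_distr_scaleR[OF v] 
    using v by (subst distr_distr) (auto simp: o_def)
  also have "\<dots> = gauss 1" by (simp add: distr_id2)
  finally have law: "distr (density lborel (gauss_density v)) borel ?E = gauss 1" .
  show ?int ?eq
    unfolding gauss_eq_density[of v] using v
    by (intro integral_log_gauss_density[OF E _ f law]; simp)+
qed

text \<open>The entropies differ only in their normalising constants. The output covariance of a row
  depends on its subcarrier alone, so the eigenvalue product is a power with exponent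
  \<open>CARD('x)\<close>, which the logarithm turns into the leading factor.\<close>

lemma mutual_information_fixed_channel:
  fixes A :: "'c::finite \<Rightarrow> complex^'t^'t" and G :: "'c \<Rightarrow> complex^'r^'t" and v :: real
  defines "J \<equiv> distr (distr (gauss 1) borel (signal A :: complex^'t^('c \<times> 'x::finite) \<Rightarrow> _) \<Otimes>\<^sub>M gauss v)
    (borel \<Otimes>\<^sub>M borel) (\<lambda>(x, w). (x, x ** stack G + w))"
  assumes v: "v > 0"
  shows "prob_space.mutual_information J 2 borel borel fst snd = prob_space.entropy J 2 lborel snd
      + (\<integral>w. log 2 (gauss_density v w) \<partial>(gauss v :: (complex^'r^('c \<times> 'x)) measure))"
    and "prob_space.mutual_information J 2 borel borel fst snd = real CARD('x) * log 2
      (v powi (- int (CARD('r) * CARD('c))) *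
       Re (det (ctranspose (block_diag G) ** block_diag (\<lambda>p. transpose (A p ** ctranspose (A p)))
           ** block_diag G + v *\<^sub>R mat 1)))"
proof -
  let ?T = "signal A :: complex^'t^('c \<times> 'x) \<Rightarrow> _"
  let ?N = "DIM(complex^'r^('c \<times> 'x))"
  define P where "P = distr (gauss 1) borel ?T"
  define B where "B p = transpose (G p) ** A p" for p
  have "\<exists>U (l :: 'r \<Rightarrow> real). ctranspose U ** U = mat 1 \<and> U ** ctranspose U = mat 1 \<and>
    B p ** ctranspose (B p) + v *\<^sub>R mat 1 = U ** diag_mat (\<lambda>j. of_real (l j)) ** ctranspose U \<and> (\<forall>j. l j > 0)" for p
    by (rule gram_plus_scalar_diagonalization[OF v, of "B p"]) blast
  then obtain U and l :: "'c \<Rightarrow> 'r \<Rightarrow> real" where U: "\<And>p. ctranspose (U p) ** U p = mat 1" "\<And>p. U p ** ctranspose (U p) = mat 1"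
    and S: "\<And>p. B p ** ctranspose (B p) + v *\<^sub>R mat 1 = U p ** diag_mat (\<lambda>j. of_real (l p j)) ** ctranspose (U p)"
    and l: "\<And>p j. l p j > 0"
    by metis
  \<comment> \<open>The product of the eigenvalues over all subcarriers for a single OFDM symbol; it
    becomes the determinant of the claim.\<close>
  define C where "C = (\<Prod>p\<in>UNIV. \<Prod>j\<in>UNIV. l p j)"
  define Z where "Z = sqrt pi ^ ?N * C ^ CARD('x)"
  have C: "C > 0" unfolding C_def using l by (intro prod_pos) auto
  have Z: "Z > 0" using C by (simp add: Z_def)
  have C': "(\<Prod>i\<in>(UNIV::('c \<times> 'x) set). \<Prod>j\<in>UNIV. l (fst i) j) = C ^ CARD('x)"
  proof -
    have "(\<Prod>i\<in>(UNIV::('c \<times> 'x) set). m (fst i)) = (\<Prod>p\<in>UNIV. \<Prod>i\<in>(UNIV::'x set). m p)"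
      for m :: "'c \<Rightarrow> real"
      unfolding UNIV_Times_UNIV[symmetric] prod.cartesian_product by (simp add: case_prod_beta)
    from this[of "\<lambda>p. \<Prod>j\<in>UNIV. l p j"] show ?thesis
      unfolding C_def by (simp add: prod_power_distrib)
  qed
  let ?L = "\<lambda>(z, w). rowmap (\<lambda>i. B (fst i)) z + sqrt v *\<^sub>R w :: complex^'r^('c \<times> 'x)"
  obtain E :: "complex^'r^('c \<times> 'x) \<Rightarrow> complex^'r^('c \<times> 'x)" where E: "linear E"
    and dens: "distr (gauss 1) borel ?L = density lborel (\<lambda>y. ennreal (exp (- (norm (E y))\<^sup>2) / Z))"
    and law: "distr (distr (gauss 1) borel ?L) borel E = gauss 1"
    by (rule distr_gauss_rowmap_plus_noise[where B="\<lambda>i::'c \<times> 'x. B (fst i)" and l="\<lambda>i. l (fst i)"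
        and U="\<lambda>i. U (fst i)", OF v l U S, unfolded C', folded Z_def])
  define f where "f y = exp (- (norm (E y))\<^sup>2) / Z" for y
  have dens': "distr (gauss 1) borel ?L = density lborel f"
    unfolding dens f_def ..
  have [measurable]: "E \<in> borel_measurable borel" by (rule borel_measurable_linear[OF E])
  have [measurable]: "f \<in> borel_measurable borel" unfolding f_def by measurable
  have [measurable]: "?T \<in> borel_measurable borel" by (rule borel_measurable_linear[OF linear_signal])
  have f_pos: "f y > 0" for y using Z by (simp add: f_def)
  have P: "prob_space P" "sets P = sets borel"
    unfolding P_def by (auto intro!: prob_space.prob_space_distr prob_space_gauss)
  have [measurable]: "(\<lambda>z. rowmap (\<lambda>i. B (fst i)) z) \<in> borel_measurable borel"
    by (rule borel_measurable_linear[OF linear_rowmap])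
  have sf: "sigma_finite_measure (gauss v :: (complex^'r^('c \<times> 'x)) measure)"
    by (rule sigma_finite_gauss[OF v])
  \<comment> \<open>Scaling the noise to variance 1 presents signal and noise as one image of a
    standard Gaussian pair, to which the law of \<open>?L\<close> applies.\<close>
  have "P \<Otimes>\<^sub>M gauss v = distr (gauss 1 \<Otimes>\<^sub>M gauss 1) (borel \<Otimes>\<^sub>M borel) (\<lambda>(z, w). (?T z, sqrt v *\<^sub>R w :: complex^'r^('c \<times> 'x)))"
    unfolding P_def using sf unfolding gauss_eq_distr_scaleR[OF v]
    by (intro pair_measure_distr) auto
  then have PG: "P \<Otimes>\<^sub>M gauss v = distr (gauss 1) (borel \<Otimes>\<^sub>M borel) (\<lambda>(z, w). (?T z, sqrt v *\<^sub>R w :: complex^'r^('c \<times> 'x)))"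
    by (simp add: gauss_prod)
  have [measurable]: "(\<lambda>x. (?T (fst x), sqrt v *\<^sub>R snd x)) \<in> measurable (gauss 1)
      (borel \<Otimes>\<^sub>M (borel :: (complex^'r^('c \<times> 'x)) measure))"
    by (subst gauss_prod[symmetric]) simp_all
  have "distr (P \<Otimes>\<^sub>M gauss v) borel (\<lambda>(x, w). x ** stack G + w :: complex^'r^('c \<times> 'x)) = distr (gauss 1) borel ?L"
    unfolding PG
    by (subst distr_distr)
      (auto simp: o_def case_prod_beta' signal_mult_stack B_def)
  then have Q: "distr (P \<Otimes>\<^sub>M density lborel (gauss_density v)) borel (\<lambda>(x, w). x ** stack G + w :: complex^'r^('c \<times> 'x)) = density lborel f"
    by (simp only: dens' gauss_eq_density[of v])
  note lawf = law[unfolded dens']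
  note int_f = integral_log_gauss_density[OF E Z f_def lawf]
  note int_g = integral_log_gauss[OF v, where 'a="complex^'r^('c \<times> 'x)", unfolded gauss_eq_density[of v]]
  have J: "J = distr (P \<Otimes>\<^sub>M density lborel (gauss_density v)) (borel \<Otimes>\<^sub>M borel) (\<lambda>(x, w). (x, x ** stack G + w))"
    unfolding J_def P_def by (simp only: gauss_eq_density[of v])
  have Gp: "prob_space (density lborel (gauss_density v) :: (complex^'r^('c \<times> 'x)) measure)"
    unfolding gauss_eq_density[of v, symmetric] by (rule prob_space_gauss[OF v])
  have \<phi>: "(\<lambda>x::complex^('c \<times> 't)^('c \<times> 'x). x ** stack G) \<in> borel_measurable borel"
    by measurable
  note MI = mutual_information_additive_noise[OF P \<phi> _ _ f_pos gauss_density_pos[OF v] Gp Q int_g(1) int_f(1) _ J]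
  have MI1: "prob_space.mutual_information J 2 borel borel fst snd = prob_space.entropy J 2 lborel snd
      + (\<integral>w. log 2 (gauss_density v w) \<partial>density lborel (gauss_density v :: complex^'r^('c \<times> 'x) \<Rightarrow> real))"
    and ent: "prob_space.entropy J 2 lborel snd = - (\<integral>y. log 2 (f y) \<partial>density lborel f)"
    by (rule MI; simp)+
  show "prob_space.mutual_information J 2 borel borel fst snd = prob_space.entropy J 2 lborel snd
      + (\<integral>w. log 2 (gauss_density v w) \<partial>(gauss v :: (complex^'r^('c \<times> 'x)) measure))"
    unfolding gauss_eq_density[of v] by (rule MI1)
  have "prob_space.mutual_information J 2 borel borel fst snd = log 2 Z - log 2 (sqrt (pi * v) ^ ?N)"
    unfolding MI1 ent int_f(2) int_g(2) by simp
  also have "\<dots> = log 2 (Z / sqrt (pi * v) ^ ?N)"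
    using Z v by (intro log_divide_pos[symmetric]) auto
  also have "Z / sqrt (pi * v) ^ ?N = (v powi (- int (CARD('r) * CARD('c))) * C) ^ CARD('x)"
  proof -
    \<comment> \<open>The real dimension \<open>?N\<close> is twice the number of complex entries,
      so the square root disappears; the powers of \<open>sqrt pi\<close> cancel against those in
      \<open>Z\<close>.\<close>
    have "sqrt v ^ ?N = (v ^ (CARD('r) * CARD('c))) ^ CARD('x)"
    proof -
      have "?N = 2 * (CARD('r) * CARD('c) * CARD('x))" by simp
      then have "sqrt v ^ ?N = ((sqrt v)\<^sup>2) ^ (CARD('r) * CARD('c) * CARD('x))"
        by (simp only: power_mult)
      then show ?thesis using v by (simp add: power_mult)
    qed
    then have "Z / sqrt (pi * v) ^ ?N = C ^ CARD('x) / (v ^ (CARD('r) * CARD('c))) ^ CARD('x)"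
      by (simp only: Z_def real_sqrt_mult power_mult_distrib) simp
    also have "\<dots> = (v powi (- int (CARD('r) * CARD('c))) * C) ^ CARD('x)"
      by (simp add: power_int_minus power_int_of_nat power_mult_distrib power_inverse divide_inverse mult.commute del: of_nat_mult)
    finally show ?thesis .
  qed
  also have "log 2 \<dots> = real CARD('x) * log 2 (v powi (- int (CARD('r) * CARD('c))) * C)"
    using C v by (intro log_nat_power) auto
  also have "C = Re (det (ctranspose (block_diag G) ** block_diag (\<lambda>p. transpose (A p ** ctranspose (A p)))
           ** block_diag G + v *\<^sub>R mat 1))"
  proof -
    have tr: "transpose (X + Y) = transpose X + transpose Y" "transpose (v *\<^sub>R mat 1) = (v *\<^sub>R mat 1 :: complex^'r^'r)"
      for X Y :: "complex^'r^'r"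
      by (auto simp: transpose_def vec_eq_iff mat_def)
    have ctr: "transpose (ctranspose (transpose X)) = ctranspose X" for X :: "complex^'r^'t"
      by (simp add: transpose_def ctranspose_def)
    have "ctranspose (G p) ** transpose (A p ** ctranspose (A p)) ** G p + v *\<^sub>R mat 1
        = transpose (B p ** ctranspose (B p) + v *\<^sub>R mat 1)" for p
      by (simp add: B_def tr ctranspose_mult matrix_transpose_mul ctr matrix_mul_assoc)
    then have "ctranspose (block_diag G) ** block_diag (\<lambda>p. transpose (A p ** ctranspose (A p)))
           ** block_diag G + v *\<^sub>R mat 1
        = transpose (block_diag (\<lambda>p. U p ** diag_mat (\<lambda>j. of_real (l p j)) ** ctranspose (U p)))"
      unfolding block_diag_mat_1[symmetric] ctranspose_block_diag block_diag_mult scaleR_block_diag block_diag_add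
        transpose_block_diag S[symmetric] by simp
    then show ?thesis
      by (simp add: det_transpose det_block_diag_diagonalized U C_def flip: of_real_prod)
  qed
  finally show "prob_space.mutual_information J 2 borel borel fst snd = real CARD('x) * log 2
      (v powi (- int (CARD('r) * CARD('c))) *
       Re (det (ctranspose (block_diag G) ** block_diag (\<lambda>p. transpose (A p ** ctranspose (A p)))
           ** block_diag G + v *\<^sub>R mat 1)))" .
qed

section \<open>Conditioning on the channel\<close>

lemma norm_vec_square: "(norm (x :: 'a::real_inner^'n))\<^sup>2 = (\<Sum>i\<in>UNIV. (norm (x $ i))\<^sup>2)"
  by (simp add: norm_vec_def L2_set_def sum_nonneg)

lemma distr_stacked_noise:
  fixes Wp :: "'w \<Rightarrow> 'c::finite \<Rightarrow> complex^'r^'x"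
  assumes M: "prob_space M" and v: "v > 0"
    and Wp: "iid_complex_normal M v UNIV (\<lambda>(p, i, j) \<omega>. Wp \<omega> p $ i $ j)"
  shows "distr M borel (\<lambda>\<omega>. stack (Wp \<omega>)) = gauss v"
proof -
  let ?Z = "\<lambda>(p, i, j) \<omega>. Wp \<omega> p $ i $ j"
  have ind: "prob_space.indep_vars M (\<lambda>_. borel) ?Z UNIV"
    and law: "\<And>u. distr M borel (?Z u) = complex_normal v"
    using Wp by (auto simp: iid_complex_normal_def)
  define flat where "flat \<omega> = (\<chi> u. ?Z u \<omega>)" for \<omega>
  \<comment> \<open>Regroups the index triple (p, i, j) into row (p, i) and column j. This only
    rearranges entries, hence is an isometry and preserves the Gaussian law.\<close>
  define r :: "complex^('c \<times> 'x \<times> 'r) \<Rightarrow> complex^'r^('c \<times> 'x)"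
    where "r z = (\<chi> u. \<chi> j. z $ (fst u, snd u, j))" for z
  have "distr M borel flat = distr (gauss v) borel (\<lambda>z. \<chi> u. z $ u)"
    unfolding flat_def
    by (rule distr_vec_indep[OF M v ind]) (simp_all add: law complex_normal_eq_gauss[OF v] distr_id2)
  then have flat: "distr M borel flat = gauss v"
    by (simp add: distr_id2)
  have lin: "linear r"
    by (rule linearI) (auto simp: r_def vec_eq_iff)
  have nm: "norm (r z) = norm z" for z
  proof -
    have "(norm (r z))\<^sup>2 = (\<Sum>u\<in>UNIV. \<Sum>j\<in>UNIV. (norm (z $ (fst u, snd u, j)))\<^sup>2)"
      by (simp add: norm_vec_square r_def)
    also have "\<dots> = (\<Sum>u\<in>UNIV. (norm (z $ u))\<^sup>2)"
      unfolding sum.cartesian_product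
      by (rule sum.reindex_bij_witness[of _ "\<lambda>(p, i, j). ((p, i), j)" "\<lambda>((p, i), j). (p, i, j)"]) auto
    also have "\<dots> = (norm z)\<^sup>2" by (simp add: norm_vec_square)
    finally show ?thesis by simp
  qed
  have [measurable]: "?Z u \<in> borel_measurable M" for u
    using ind unfolding prob_space.indep_vars_def2[OF M] by blast
  have [measurable]: "flat \<in> borel_measurable M"
    unfolding flat_def by (intro borel_measurable_vec_lambda) auto
  have "stack (Wp \<omega>) = r (flat \<omega>)" for \<omega>
    by (simp add: stack_def r_def flat_def vec_eq_iff)
  then have "distr M borel (\<lambda>\<omega>. stack (Wp \<omega>)) = distr (distr M borel flat) borel r"
    using borel_measurable_linear[OF lin] by (subst distr_distr) (auto simp: o_def)
  then show ?thesis
    using gauss_distr_isometry[OF lin nm] by (simp add: flat)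
qed

text \<open>Independent rows come from one standard Gaussian matrix; placing them in their blocks is
  a further linear map.\<close>

lemma distr_block_diag_signal:
  fixes X :: "'w \<Rightarrow> 'c::finite \<Rightarrow> complex^'t^'x"
  assumes M: "prob_space M"
    and ind: "prob_space.indep_vars M (\<lambda>_. borel) (\<lambda>(p, i) \<omega>. X \<omega> p $ i) UNIV"
    and law: "\<And>p i. distr M borel (\<lambda>\<omega>. X \<omega> p $ i)
      = distr (\<Pi>\<^sub>M k\<in>UNIV. complex_normal 1) borel (\<lambda>z. A p *v (\<chi> k. z k))"
  shows "distr M borel (\<lambda>\<omega>. block_diag (X \<omega>)) = distr (gauss 1) borel (signal A)"
proof -
  let ?Z = "\<lambda>(p, i) \<omega>. X \<omega> p $ i"
  define rows where "rows \<omega> = (\<chi> u. ?Z u \<omega>)" for \<omega>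
  define b :: "complex^'t^('c \<times> 'x) \<Rightarrow> complex^('c \<times> 't)^('c \<times> 'x)"
    where "b z = block_diag (\<lambda>p. \<chi> i. z $ (p, i))" for z
  have mA [measurable]: "(*v) (A p) \<in> borel_measurable borel" for p
    by (intro borel_measurable_linear matrix_vector_mul_linear)
  have [measurable]: "(\<lambda>z. \<chi> k. z k) \<in> borel_measurable (\<Pi>\<^sub>M k\<in>(UNIV :: 't set). (gauss 1 :: complex measure))"
    by (intro borel_measurable_vec_lambda) auto
  have row: "distr M borel (?Z u) = distr (gauss 1) borel (\<lambda>z. A (fst u) *v z)" for u
  proof -
    have "distr (gauss 1) borel (\<lambda>z. A (fst u) *v z)
      = distr (\<Pi>\<^sub>M k\<in>UNIV. gauss 1) borel (\<lambda>z. A (fst u) *v (\<chi> k. z k))"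
      by (subst gauss_vec, simp, subst distr_distr) (auto simp: o_def)
    then show ?thesis by (simp add: case_prod_beta law complex_normal_eq_gauss)
  qed
  have rows: "distr M borel rows = distr (gauss 1) borel (\<lambda>z. \<chi> u. A (fst u) *v z $ u)"
    unfolding rows_def by (rule distr_vec_indep[OF M _ ind row]) auto
  have [measurable]: "?Z u \<in> borel_measurable M" for u
    using ind unfolding prob_space.indep_vars_def2[OF M] by blast
  have [measurable]: "rows \<in> borel_measurable M"
    unfolding rows_def by (intro borel_measurable_vec_lambda) auto
  have [measurable]: "b \<in> borel_measurable borel"
    by (rule borel_measurable_linear, rule linearI) (auto simp: b_def block_diag_def vec_eq_iff)
  have [measurable]: "(\<lambda>z::complex^'t^('c \<times> 'x). \<chi> u. A (fst u) *v z $ u) \<in> borel_measurable borel"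
    using borel_measurable_linear[OF linear_rowmap] by (simp add: rowmap_def[abs_def])
  have "distr M borel (\<lambda>\<omega>. block_diag (X \<omega>)) = distr (distr M borel rows) borel b"
    by (subst distr_distr) (auto simp: o_def b_def rows_def)
  also have "\<dots> = distr (gauss 1) borel (\<lambda>z. b (\<chi> u. A (fst u) *v z $ u))"
    unfolding rows by (subst distr_distr) (auto simp: o_def)
  also have "(\<lambda>z. b (\<chi> u. A (fst u) *v z $ u)) = signal A"
    by (auto simp: b_def signal_def)
  finally show ?thesis .
qed

text \<open>\<open>K\<close> evaluated at the channel is the joint law of transmitted and received
  signal for that realization, so both equalities hold per realization and not merely on average; a
  version of a conditional law is determined only up to a null set, hence the \<open>AE\<close>.
  Taking \<open>Re\<close> loses nothing, since the determinant is a product of positive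
  eigenvalues.\<close>

theorem theorem2:
  fixes M :: "'w measure"
    and X :: "'w \<Rightarrow> 'c::{finite,linorder} \<Rightarrow> complex^'t^'x"
    and H :: "'w \<Rightarrow> 'c \<Rightarrow> complex^'r^'t"
    and W Y :: "'w \<Rightarrow> complex^'r^('c \<times> 'x)"
    and Wp :: "'w \<Rightarrow> 'c \<Rightarrow> complex^'r^'x"
    and Lc :: nat
    and R :: "nat \<Rightarrow> complex^'t^'t"
    and Hw :: "'w \<Rightarrow> nat \<Rightarrow> complex^'r^'t"
    and \<sigma>2 :: real
    and \<Sigma>X :: "complex^('c \<times> 't)^('c \<times> 't)"
    and K :: "complex^'r^('c \<times> 't)
                \<Rightarrow> ((complex^('c \<times> 't)^('c \<times> 'x)) \<times> (complex^'r^('c \<times> 'x))) measure"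
  assumes M: "prob_space M"
    \<comment> \<open>channel\<close>
    and R: "\<And>l. l \<le> Lc \<Longrightarrow> psd (R l)"
    and Hw: "iid_complex_normal M 1 ({..Lc} \<times> UNIV) (\<lambda>(l, i, j) \<omega>. Hw \<omega> l $ i $ j)"
    and H: "\<And>\<omega>. H \<omega> = freq_channel Lc (\<lambda>l. psd_sqrt (R l) ** Hw \<omega> l)"
    \<comment> \<open>noise\<close>
    and \<sigma>2: "\<sigma>2 > 0"
    and Wp: "iid_complex_normal M \<sigma>2 UNIV (\<lambda>(p, i, j) \<omega>. Wp \<omega> p $ i $ j)"
    and W: "\<And>\<omega>. W \<omega> = stack (Wp \<omega>)"
    \<comment> \<open>Gaussian signalling\<close>
    and X_indep: "prob_space.indep_vars M (\<lambda>_. borel) (\<lambda>(p, i) \<omega>. X \<omega> p $ i) UNIV"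
    and X_ident: "\<And>p i k. distr M borel (\<lambda>\<omega>. X \<omega> p $ i) = distr M borel (\<lambda>\<omega>. X \<omega> p $ k)"
    and X_gauss: "\<And>p i. circular_gaussian (distr M borel (\<lambda>\<omega>. X \<omega> p $ i))"
    \<comment> \<open>channel, signal and noise are mutually independent\<close>
    and indep_H: "indep_rvs M borel (\<lambda>\<omega>. stack (H \<omega>))
                    (borel \<Otimes>\<^sub>M borel) (\<lambda>\<omega>. (block_diag (X \<omega>), W \<omega>))"
    and indep_XW: "indep_rvs M borel (\<lambda>\<omega>. block_diag (X \<omega>)) borel W"
    \<comment> \<open>received signal, and its law jointly with the transmitted signal given the channel\<close>
    and Y: "\<And>\<omega>. Y \<omega> = block_diag (X \<omega>) ** stack (H \<omega>) + W \<omega>"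
    and K: "cond_law M borel (borel \<Otimes>\<^sub>M borel) (\<lambda>\<omega>. stack (H \<omega>))
              (\<lambda>\<omega>. (block_diag (X \<omega>), Y \<omega>)) K"
    and \<Sigma>X: "\<Sigma>X = (1 / real CARD('x)) *\<^sub>R
                (LINT \<omega>|M. ctranspose (block_diag (X \<omega>)) ** block_diag (X \<omega>))"
  shows "AE \<omega> in M.
    prob_space.mutual_information (K (stack (H \<omega>))) 2 borel borel fst snd
      = prob_space.entropy (K (stack (H \<omega>))) 2 lborel snd - prob_space.entropy M 2 lborel W
  \<and> prob_space.mutual_information (K (stack (H \<omega>))) 2 borel borel fst snd
      = real CARD('x) * log 2
          (\<sigma>2 powi (- int (CARD('r) * CARD('c)))
            * Re (det (ctranspose (block_diag (H \<omega>)) ** \<Sigma>X ** block_diag (H \<omega>) + \<sigma>2 *\<^sub>R mat 1)))"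
proof -
  interpret prob_space M by fact
  let ?B = "\<lambda>\<omega>. block_diag (X \<omega>)"
  have "\<exists>A :: complex^'t^'t. \<forall>i. distr M borel (\<lambda>\<omega>. X \<omega> p $ i)
      = distr (\<Pi>\<^sub>M k\<in>UNIV. complex_normal 1) borel (\<lambda>z. A *v (\<chi> k. z k))" for p
  proof -
    \<comment> \<open>\<open>undefined\<close> is an arbitrary row index: the factor found for one
      row serves every row of the subcarrier because their laws coincide.\<close>
    obtain A0 :: "complex^'t^'t" where A0: "distr M borel (\<lambda>\<omega>. X \<omega> p $ undefined)
        = distr (\<Pi>\<^sub>M k\<in>UNIV. complex_normal 1) borel (\<lambda>z. A0 *v (\<chi> k. z k))"
      using X_gauss[of p undefined] unfolding circular_gaussian_def by blast
    show ?thesis by (intro exI[of _ A0] allI trans[OF X_ident A0])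
  qed
  then obtain A :: "'c \<Rightarrow> complex^'t^'t" where A: "\<And>p i. distr M borel (\<lambda>\<omega>. X \<omega> p $ i)
      = distr (\<Pi>\<^sub>M k\<in>UNIV. complex_normal 1) borel (\<lambda>z. A p *v (\<chi> k. z k))"
    by metis
  have law_X: "distr M borel ?B = distr (gauss 1) borel (signal A)"
    by (rule distr_block_diag_signal[OF M X_indep A])
  have law_W: "distr M borel W = gauss \<sigma>2"
    unfolding W[abs_def] by (rule distr_stacked_noise[OF M \<sigma>2 Wp])
  have B_meas [measurable]: "?B \<in> borel_measurable M" and W_meas [measurable]: "W \<in> borel_measurable M"
    using indep_XW by (auto simp: indep_rvs_def)
  have H_meas [measurable]: "(\<lambda>\<omega>. stack (H \<omega>)) \<in> borel_measurable M"
    using indep_H by (auto simp: indep_rvs_def)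
  have law_XW: "distr M (borel \<Otimes>\<^sub>M borel) (\<lambda>\<omega>. (?B \<omega>, W \<omega>)) = distr (gauss 1) borel (signal A) \<Otimes>\<^sub>M gauss \<sigma>2"
    by (simp only: indep_rvs_distr_pair[OF M indep_XW] law_X law_W)
  define F :: "complex^'r^('c \<times> 't) \<Rightarrow> (complex^('c \<times> 't)^('c \<times> 'x)) \<times> (complex^'r^('c \<times> 'x)) \<Rightarrow>
      (complex^('c \<times> 't)^('c \<times> 'x)) \<times> (complex^'r^('c \<times> 'x))"
    where "F h = (\<lambda>(x, w). (x, x ** h + w))" for h
  \<comment> \<open>Independence of the channel from the pair (signal, noise) gives an explicit
    version of the conditional law; \<open>K\<close> agrees with it almost everywhere.\<close>
  have "cond_law M borel (borel \<Otimes>\<^sub>M borel) (\<lambda>\<omega>. stack (H \<omega>)) (\<lambda>\<omega>. F (stack (H \<omega>)) (?B \<omega>, W \<omega>))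
     (\<lambda>h. distr (distr M (borel \<Otimes>\<^sub>M borel) (\<lambda>\<omega>. (?B \<omega>, W \<omega>))) (borel \<Otimes>\<^sub>M borel) (F h))"
    by (rule cond_law_of_independent[OF M indep_H]) (simp add: F_def case_prod_beta')
  then have K': "cond_law M borel borel (\<lambda>\<omega>. stack (H \<omega>)) (\<lambda>\<omega>. (?B \<omega>, Y \<omega>))
     (\<lambda>h. distr (distr (gauss 1) borel (signal A) \<Otimes>\<^sub>M gauss \<sigma>2) (borel \<Otimes>\<^sub>M borel) (F h))"
    by (simp add: F_def Y law_XW[unfolded borel_prod] borel_prod)
  have ae: "AE \<omega> in M. K (stack (H \<omega>))
      = distr (distr (gauss 1) borel (signal A) \<Otimes>\<^sub>M gauss \<sigma>2) (borel \<Otimes>\<^sub>M borel) (F (stack (H \<omega>)))"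
    by (rule cond_law_unique[OF M H_meas K[unfolded borel_prod] K'])
  have "prob_space.entropy M 2 lborel W = - (\<integral>w. log 2 (gauss_density \<sigma>2 w) \<partial>density lborel (gauss_density \<sigma>2 :: complex^'r^('c \<times> 'x) \<Rightarrow> real))"
  proof (rule prob_space_entropy_density[OF M])
    have "distr M lborel W = distr M borel W" by (rule distr_cong) auto
    then show "distr M lborel W = density lborel (gauss_density \<sigma>2)"
      by (simp only: law_W gauss_eq_density)
  qed (auto intro: less_imp_le gauss_density_pos \<sigma>2)
  then have ent_W: "prob_space.entropy M 2 lborel W = - (\<integral>w. log 2 (gauss_density \<sigma>2 w) \<partial>(gauss \<sigma>2 :: (complex^'r^('c \<times> 'x)) measure))"
    by (simp only: gauss_eq_density[of \<sigma>2])
  have \<Sigma>: "\<Sigma>X = block_diag (\<lambda>p. Finite_Cartesian_Product.transpose (A p ** ctranspose (A p)))"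
  proof -
    have [measurable]: "(signal A :: complex^'t^('c \<times> 'x) \<Rightarrow> _) \<in> borel_measurable borel"
      by (rule borel_measurable_linear[OF linear_signal])
    have "(LINT \<omega>|M. ctranspose (?B \<omega>) ** ?B \<omega>) = (LINT x|distr M borel ?B. ctranspose x ** x)"
      by (subst integral_distr) auto
    also have "\<dots> = (LINT z|gauss 1. ctranspose (signal A z) ** signal A (z :: complex^'t^('c \<times> 'x)))"
      unfolding law_X
      by (subst integral_distr) auto
    also have "\<dots> = real CARD('x) *\<^sub>R block_diag (\<lambda>p. Finite_Cartesian_Product.transpose (A p ** ctranspose (A p)))"
      by (rule has_bochner_integral_integral_eq[OF has_bochner_integral_signal_gram])
    finally show ?thesis by (simp add: \<Sigma>X)
  qed
  show ?thesis
    using ae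
  proof (rule AE_mp, intro AE_I2 impI)
    fix \<omega>
    assume K\<omega>: "K (stack (H \<omega>))
      = distr (distr (gauss 1) borel (signal A) \<Otimes>\<^sub>M gauss \<sigma>2) (borel \<Otimes>\<^sub>M borel) (F (stack (H \<omega>)))"
    show "prob_space.mutual_information (K (stack (H \<omega>))) 2 borel borel fst snd
      = prob_space.entropy (K (stack (H \<omega>))) 2 lborel snd - prob_space.entropy M 2 lborel W
    \<and> prob_space.mutual_information (K (stack (H \<omega>))) 2 borel borel fst snd
      = real CARD('x) * log 2
          (\<sigma>2 powi (- int (CARD('r) * CARD('c)))
            * Re (det (ctranspose (block_diag (H \<omega>)) ** \<Sigma>X ** block_diag (H \<omega>) + \<sigma>2 *\<^sub>R mat 1)))"
      using mutual_information_fixed_channel[OF \<sigma>2, of A "H \<omega>", where 'x='x]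
      unfolding K\<omega> F_def ent_W \<Sigma> by simp
  qed
qed

end
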